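(* Let $n\ge 3$ be a number of players. Computing a connected $\epsilon$-envy-free allocation for $n$ players requires $\Omega(\log\frac1\epsilon)$ queries in the Robertson–Webb (RW) model. That is, for every $n\ge3$ there are constants $c>0$ and $\epsilon_0\in(0,1)$ such that for every $0<\epsilon<\epsilon_0$, every deterministic RW protocol that outputs a connected $\epsilon$-envy-free allocation for every choice of value densities $v_1,\dots,v_n$ asks at least $c\log\frac1\epsilon$ queries on some instance.
   Context: Cake cutting model. The cake is $[0,1]$ and the players are $N=\{1,\dots,n\}$. Player $i$ has a private non-negative integrable value density $v_i$ on $[0,1]$ with $\int_0^1 v_i=1$, and values a measurable set $S$ at $V_i(S)=\int_S v_i(x)\,dx$. A piece is a finite union of disjoint intervals (shared endpoints are irrelevant, since sets of measure zero are worth zero); it is connected if it is a single interval. An allocation $A=(A_1,\dots,A_n)$ is a partition of $[0,1]$ into pieces, player $i$ receiving $A_i$. It is connected if every $A_i$ is connected, and $\epsilon$-envy-free if $V_i(A_i)\ge V_i(A_j)-\epsilon$ for all $i,j$. RW model. A protocol, not knowing the densities, adaptively asks the players queries of two types: $\mathrm{Cut}_i(\alpha)$, for any $\alpha\in[0,1]$: player $i$ returns a point $y$ with $V_i([0,y])=\alpha$ (ties resolved deterministically, e.g. the leftmost such point), and $y$ becomes a cut point; $\mathrm{Eval}_i(y)$, for a previously made cut point $y$: player $i$ returns $V_i([0,y])$. At the end the protocol outputs an allocation demarcated by cut points discovered through its queries. Protocols are deterministic and the number of queries is counted in the worst case over instances. *)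

theory Defs
  imports "HOL-Analysis.Analysis"
begin

section \<open>Cake, densities, allocations\<close>

definition density :: "(real \<Rightarrow> real) \<Rightarrow> bool" where
  "density f \<longleftrightarrow> f absolutely_integrable_on {0..1} \<and> (\<forall>x\<in>{0..1}. 0 \<le> f x) \<and>
     set_lebesgue_integral lebesgue {0..1} f = 1"

definition val :: "(real \<Rightarrow> real) \<Rightarrow> real set \<Rightarrow> real" where
  "val f S = set_lebesgue_integral lebesgue S f"

definition cake_instance :: "nat \<Rightarrow> (nat \<Rightarrow> real \<Rightarrow> real) \<Rightarrow> bool" where
  "cake_instance n v \<longleftrightarrow> (\<forall>i\<in>{1..n}. density (v i))"

definition piece :: "real set \<Rightarrow> bool" where
  "piece S \<longleftrightarrow> (\<exists>F. finite F \<and> disjoint F \<and> (\<forall>I\<in>F. is_interval I) \<and> S = \<Union>F)"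

text \<open>Intervals may be open, closed or half-open, and distinct shares may overlap in a null set,
  so that it does not matter who receives a shared endpoint.\<close>

definition allocation :: "nat \<Rightarrow> (nat \<Rightarrow> real set) \<Rightarrow> bool" where
  "allocation n A \<longleftrightarrow> (\<forall>i\<in>{1..n}. piece (A i)) \<and> (\<Union>i\<in>{1..n}. A i) = {0..1} \<and>
     (\<forall>i\<in>{1..n}. \<forall>j\<in>{1..n}. i \<noteq> j \<longrightarrow> negligible (A i \<inter> A j))"

definition connected_allocation :: "nat \<Rightarrow> (nat \<Rightarrow> real set) \<Rightarrow> bool" where
  "connected_allocation n A \<longleftrightarrow> allocation n A \<and> (\<forall>i\<in>{1..n}. is_interval (A i))"

definition envy_free :: "nat \<Rightarrow> (nat \<Rightarrow> real \<Rightarrow> real) \<Rightarrow> real \<Rightarrow> (nat \<Rightarrow> real set) \<Rightarrow> bool" where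
  "envy_free n v \<epsilon> A \<longleftrightarrow>
     (\<forall>i\<in>{1..n}. \<forall>j\<in>{1..n}. val (v i) (A i) \<ge> val (v i) (A j) - \<epsilon>)"


section \<open>The Robertson--Webb model\<close>

datatype query = Cut nat real | Eval nat real

datatype action = Ask query | Output "nat \<Rightarrow> real set"

type_synonym history = "(query \<times> real) list"

text \<open>A protocol maps the queries asked so far, with their answers, to its next action.  Unlike a
  well-founded decision tree, this allows protocols that halt on every instance without a uniform
  reason for doing so.\<close>

type_synonym protocol = "history \<Rightarrow> action"

text \<open>A deterministic way for the players to answer cut queries: \<open>C i f \<alpha>\<close> is the point returned
  by player \<open>i\<close> with density \<open>f\<close>. It is determined by \<open>f\<close> and \<open>\<alpha>\<close> except for ties.\<close>

definition cut_rule :: "(nat \<Rightarrow> (real \<Rightarrow> real) \<Rightarrow> real \<Rightarrow> real) \<Rightarrow> bool" where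
  "cut_rule C \<longleftrightarrow> (\<forall>i f \<alpha>. density f \<longrightarrow> \<alpha> \<in> {0..1} \<longrightarrow>
     C i f \<alpha> \<in> {0..1} \<and> val f {0..C i f \<alpha>} = \<alpha>)"

definition leftmost_cut :: "nat \<Rightarrow> (real \<Rightarrow> real) \<Rightarrow> real \<Rightarrow> real" where
  "leftmost_cut i f \<alpha> = Inf {y\<in>{0..1}. val f {0..y} = \<alpha>}"

lemma cut_rule_leftmost: "cut_rule leftmost_cut"
  unfolding cut_rule_def
proof (intro allI impI)
  fix i :: nat and f :: "real \<Rightarrow> real" and \<alpha> :: real
  assume d: "density f" and a: "\<alpha> \<in> {0..1}"
  let ?S = "{y\<in>{0..1}. val f {0..y} = \<alpha>}"
  have ai: "f absolutely_integrable_on {0..1}" using d by (simp add: density_def)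
  have vi: "val f {0..y} = integral {0..y} f" if "y \<in> {0..1}" for y
  proof -
    have "f absolutely_integrable_on {0..y}"
      by (rule set_integrable_subset[OF ai]) (use that in simp_all)
    thus ?thesis unfolding val_def by (rule set_lebesgue_integral_eq_integral(2))
  qed
  have "continuous_on {0..1} (\<lambda>y. integral {0..y} f)"
    by (rule indefinite_integral_continuous_1[OF set_lebesgue_integral_eq_integral(1)[OF ai]])
  hence c: "continuous_on {0..1} (\<lambda>y. val f {0..y})"
    by (rule continuous_on_eq) (simp add: vi)
  have "val f {0..0} = 0" using vi[of 0] by simp
  moreover have "val f {0..1} = 1" using d by (simp add: density_def val_def)
  ultimately have "\<exists>y\<ge>0. y \<le> 1 \<and> val f {0..y} = \<alpha>"
    using a c by (intro IVT') simp_all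
  then obtain y where y: "0 \<le> y" "y \<le> 1" "val f {0..y} = \<alpha>" by blast
  hence "y \<in> ?S" by simp
  hence ne: "?S \<noteq> {}" by blast
  have cl: "closed ?S"
    by (rule continuous_closed_preimage_constant[OF c closed_atLeastAtMost])
  have bd: "bdd_below ?S" by (rule bdd_belowI[of _ 0]) simp
  have "leftmost_cut i f \<alpha> \<in> ?S"
    unfolding leftmost_cut_def by (rule closed_contains_Inf[OF ne bd cl])
  thus "leftmost_cut i f \<alpha> \<in> {0..1} \<and> val f {0..leftmost_cut i f \<alpha>} = \<alpha>"
    by simp
qed

context
  fixes C :: "nat \<Rightarrow> (real \<Rightarrow> real) \<Rightarrow> real \<Rightarrow> real"
begin

fun answer :: "(nat \<Rightarrow> real \<Rightarrow> real) \<Rightarrow> query \<Rightarrow> real" where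
  "answer v (Cut i \<alpha>) = C i (v i) \<alpha>"
| "answer v (Eval i y) = val (v i) {0..y}"

text \<open>The history after \<open>k\<close> steps; it stays constant once the protocol has produced its output.\<close>

fun run :: "protocol \<Rightarrow> (nat \<Rightarrow> real \<Rightarrow> real) \<Rightarrow> nat \<Rightarrow> history" where
  "run P v 0 = []"
| "run P v (Suc k) = (case P (run P v k) of
      Ask q \<Rightarrow> run P v k @ [(q, answer v q)]
    | Output A \<Rightarrow> run P v k)"

end

definition cut_points :: "history \<Rightarrow> real set" where
  "cut_points h = {y. \<exists>i \<alpha>. (Cut i \<alpha>, y) \<in> set h}"

text \<open>The endpoints of the maximal intervals of a piece \<open>S\<close> are the points of \<open>frontier S\<close>; they
  have to be cut points or ends of the cake.\<close>

fun legal_action :: "nat \<Rightarrow> history \<Rightarrow> action \<Rightarrow> bool" where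
  "legal_action n h (Ask (Cut i \<alpha>)) \<longleftrightarrow> i \<in> {1..n} \<and> \<alpha> \<in> {0..1}"
| "legal_action n h (Ask (Eval i y)) \<longleftrightarrow> i \<in> {1..n} \<and> y \<in> cut_points h"
| "legal_action n h (Output A) \<longleftrightarrow>
     allocation n A \<and> (\<forall>i\<in>{1..n}. frontier (A i) \<subseteq> {0, 1} \<union> cut_points h)"

definition rw_protocol ::
    "nat \<Rightarrow> (nat \<Rightarrow> (real \<Rightarrow> real) \<Rightarrow> real \<Rightarrow> real) \<Rightarrow> protocol \<Rightarrow> bool" where
  "rw_protocol n C P \<longleftrightarrow>
     (\<forall>v. cake_instance n v \<longrightarrow> (\<forall>k. legal_action n (run C P v k) (P (run C P v k))))"

definition outputs ::
    "(nat \<Rightarrow> (real \<Rightarrow> real) \<Rightarrow> real \<Rightarrow> real) \<Rightarrow> protocol \<Rightarrow> (nat \<Rightarrow> real \<Rightarrow> real) \<Rightarrow>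
      (nat \<Rightarrow> real set) \<Rightarrow> bool" where
  "outputs C P v A \<longleftrightarrow> (\<exists>k. P (run C P v k) = Output A)"

text \<open>Only meaningful if the protocol halts on \<open>v\<close>.\<close>

definition num_queries ::
    "(nat \<Rightarrow> (real \<Rightarrow> real) \<Rightarrow> real \<Rightarrow> real) \<Rightarrow> protocol \<Rightarrow> (nat \<Rightarrow> real \<Rightarrow> real) \<Rightarrow> nat" where
  "num_queries C P v = (LEAST k. \<exists>A. P (run C P v k) = Output A)"

definition computes_connected_envy_free ::
    "nat \<Rightarrow> real \<Rightarrow> (nat \<Rightarrow> (real \<Rightarrow> real) \<Rightarrow> real \<Rightarrow> real) \<Rightarrow> protocol \<Rightarrow> bool" where
  "computes_connected_envy_free n \<epsilon> C P \<longleftrightarrow>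
     (\<forall>v. cake_instance n v \<longrightarrow>
        (\<exists>A. outputs C P v A \<and> connected_allocation n A \<and> envy_free n v \<epsilon> A))"

end

theory Submission
  imports Defs
begin

text \<open>
  Only players 1, 2 and 3 compete for \<open>[0, 3/4]\<close>; the others want \<open>[3/4, 1]\<close> and nothing else, so
  that in an envy-free connected allocation the first three pieces \<open>[0,x]\<close>, \<open>[x,y]\<close>, \<open>[y,t]\<close> go
  to players 1, 2 and 3. Near the division \<open>x = 1/4\<close>, \<open>y = 1/2\<close>, \<open>t \<ge> 3/4\<close> player 1 is indifferent
  between the middle and the right piece, player 2 between the left and the right one, and player 3
  between the left and the middle one, while each of them clearly dislikes the remaining piece.
  Player 3 then forces \<open>y = 2x\<close>. On this curve players 1 and 2 change their preference at a
  parameter that depends on their values near \<open>y = 1/2\<close>; if both change at the same point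
  \<open>y = 1/2 + \<tau>\<close>, then \<open>y\<close> must be within \<open>O(\<epsilon>)\<close> of this point.

  An adversary keeps \<open>\<tau>\<close> hidden. It fixes the distribution functions of players 1 and 2 outside
  an interval of radius \<open>r\<close> around \<open>1/2 + \<tau>\<close>. A query asks for one value or one preimage of one of these
  functions, and one of the two choices \<open>\<tau> \<plusminus> r/2\<close>, with radius \<open>r/8\<close>, makes its answer independent of
  what remains open. Hence \<open>K\<close> queries leave two instances at distance \<open>\<delta> / 8 ^ K\<close> that the
  protocol cannot tell apart.
\<close>

section \<open>Distribution functions\<close>

text \<open>\<open>F\<close> is fixed on the whole line and is 0 left of the cake, where
  \<open>{0..y}\<close> is empty. Thus \<open>has_cdf_val\<close> holds for every real
  \<open>y\<close>, and an \<open>Eval\<close> query needs no case distinction on its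
  position.\<close>

definition has_cdf :: "(real \<Rightarrow> real) \<Rightarrow> (real \<Rightarrow> real) \<Rightarrow> bool" where
  "has_cdf f F \<longleftrightarrow> (\<forall>x. 0 \<le> f x) \<and> (\<forall>y<0. F y = 0) \<and>
     (\<forall>y\<ge>0. (f has_integral F y) {0..y}) \<and> F 1 = 1"

lemma has_cdf_nonneg: "has_cdf f F \<Longrightarrow> 0 \<le> f x"
  by (simp add: has_cdf_def)

lemma has_cdf_1: "has_cdf f F \<Longrightarrow> F 1 = 1"
  by (simp add: has_cdf_def)

lemma has_cdf_integral: "has_cdf f F \<Longrightarrow> 0 \<le> y \<Longrightarrow> (f has_integral F y) {0..y}"
  by (simp add: has_cdf_def)

lemma has_cdf_0: assumes "has_cdf f F" shows "F 0 = 0"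
proof -
  have "(f has_integral F 0) {0..0}" by (rule has_cdf_integral[OF assms]) simp
  moreover have "(f has_integral 0) {0..0}" by (simp add: has_integral_refl)
  ultimately show ?thesis by (rule has_integral_unique)
qed

lemma has_cdf_has_integral:
  assumes "has_cdf f F" "0 \<le> a" "a \<le> b"
  shows "(f has_integral (F b - F a)) {a..b}"
proof -
  have A: "(f has_integral F a) {0..a}" and B: "(f has_integral F b) {0..b}"
    using assms by (auto simp: has_cdf_def)
  have "f integrable_on {a..b}"
    by (rule integrable_on_subinterval[of _ "{0..b}"]) (use B assms in \<open>auto simp: has_integral_integrable\<close>)
  then obtain I where I: "(f has_integral I) {a..b}" by blast
  have "(f has_integral (F a + I)) {0..b}"
    by (rule has_integral_combine[OF _ _ A I]) (use assms in auto)
  hence "F b = F a + I" using B has_integral_unique by blast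
  with I show ?thesis by simp
qed

lemma has_cdf_absolutely_integrable:
  assumes "has_cdf f F" "S \<subseteq> {0..1}" "S \<in> sets lebesgue"
  shows "f absolutely_integrable_on S"
proof -
  have "(f has_integral F 1) {0..1}" by (rule has_cdf_integral[OF assms(1)]) simp
  hence "f absolutely_integrable_on {0..1}"
    by (intro nonnegative_absolutely_integrable_1)
       (use assms in \<open>auto simp: has_cdf_def has_integral_integrable\<close>)
  thus ?thesis using assms by (auto intro: set_integrable_subset)
qed

lemma has_cdf_absolutely_integrable_Icc:
  assumes "has_cdf f F" "0 \<le> a" "a \<le> b"
  shows "f absolutely_integrable_on {a..b}"
  using has_cdf_has_integral[OF assms] assms
  by (intro nonnegative_absolutely_integrable_1) (auto simp: has_cdf_def has_integral_integrable)

lemma has_cdf_density: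
  assumes "has_cdf f F"
  shows "density f"
proof -
  have "(f has_integral 1) {0..1}"
    using has_cdf_integral[OF assms, of 1] has_cdf_1[OF assms] by simp
  moreover have "f absolutely_integrable_on {0..1}"
    by (rule has_cdf_absolutely_integrable[OF assms]) auto
  ultimately show ?thesis unfolding density_def
    using has_cdf_nonneg[OF assms] set_lebesgue_integral_eq_integral(2) integral_unique by metis
qed

lemma has_cdf_val:
  assumes "has_cdf f F"
  shows "val f {0..y} = F y"
proof (cases "y < 0")
  case True
  thus ?thesis using assms by (simp add: has_cdf_def val_def set_lebesgue_integral_def)
next
  case False
  hence y: "0 \<le> y" by simp
  show ?thesis unfolding val_def
    using set_lebesgue_integral_eq_integral(2)[OF has_cdf_absolutely_integrable_Icc[OF assms _ y]]
      has_cdf_has_integral[OF assms _ y] has_cdf_0[OF assms] by (simp add: integral_unique)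
qed

lemma has_cdf_slope:
  assumes "has_cdf f F" "0 \<le> a" "a \<le> b" "\<And>x. x \<in> {a..b} \<Longrightarrow> c \<le> f x"
  shows "c * (b - a) \<le> F b - F a"
proof -
  have "((\<lambda>_. c) has_integral c * (b - a)) {a..b}"
    using has_integral_const_real[of c a b] assms by (simp add: mult.commute)
  from has_integral_le[OF this has_cdf_has_integral[OF assms(1-3)]] assms(4) show ?thesis by simp
qed

lemma has_cdf_mono:
  assumes "has_cdf f F" "a \<le> b"
  shows "F a \<le> F b"
proof -
  have *: "F a \<le> F b" if "0 \<le> a" "a \<le> b" for a b
    using has_cdf_slope[OF assms(1) that, of 0] has_cdf_nonneg[OF assms(1)] by simp
  show ?thesis
  proof (cases "a < 0")
    case True
    show ?thesis
      using True assms has_cdf_0[OF assms(1)] *[of 0 b] unfolding has_cdf_def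
      by (cases "b < 0") auto
  qed (use assms * in auto)
qed

section \<open>Bending a distribution function through a prescribed point\<close>

definition bend :: "real \<Rightarrow> real \<Rightarrow> real \<Rightarrow> real \<Rightarrow> (real \<Rightarrow> real) \<Rightarrow> real \<Rightarrow> real" where
  "bend a p b q F x =
     (if x \<le> a \<or> b \<le> x then F x
      else if x \<le> p then F a + (q - F a) / (p - a) * (x - a)
      else q + (F b - q) / (b - p) * (x - p))"

text \<open>The new slopes sit on intervals open on the left and closed on the right, the form that
  \<open>has_integral_step\<close> accepts. The changed value at \<open>b\<close> itself is a null
  set for the part to the right of \<open>b\<close>.\<close>

definition bend_density ::
    "real \<Rightarrow> real \<Rightarrow> real \<Rightarrow> real \<Rightarrow> (real \<Rightarrow> real) \<Rightarrow> (real \<Rightarrow> real) \<Rightarrow> real \<Rightarrow> real" where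
  "bend_density a p b q F f x =
     (if x \<le> a \<or> b < x then f x
      else if x \<le> p then (q - F a) / (p - a) else (F b - q) / (b - p))"

lemma has_integral_step:
  fixes f :: "real \<Rightarrow> real"
  assumes "c \<le> d" "\<And>x. c < x \<Longrightarrow> x \<le> d \<Longrightarrow> f x = s"
  shows "(f has_integral s * (d - c)) {c..d}"
proof (rule has_integral_spike_finite[of "{c}"])
  show "((\<lambda>_. s) has_integral s * (d - c)) {c..d}"
    using has_integral_const_real[of s c d] assms by (simp add: mult.commute)
qed (use assms in auto)

lemma has_cdf_bend:
  assumes F: "has_cdf f F" and o: "0 \<le> a" "a < p" "p < b" "b \<le> 1" and q: "F a \<le> q" "q \<le> F b"
  shows "has_cdf (bend_density a p b q F f) (bend a p b q F)" (is "has_cdf ?f ?G")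
proof -
  have neg: "\<forall>y<0. ?G y = 0" using F o by (auto simp: bend_def has_cdf_def)
  have nn: "\<forall>x. 0 \<le> ?f x" using F o q by (auto simp: bend_density_def has_cdf_def)
  have one: "?G 1 = 1" using F o by (auto simp: bend_def has_cdf_def)
  have A: "(?f has_integral F y) {0..y}" if "0 \<le> y" "y \<le> a" for y
  proof (rule has_integral_eq)
    show "(f has_integral F y) {0..y}" using F that by (simp add: has_cdf_def)
  qed (use that in \<open>auto simp: bend_density_def\<close>)
  have B: "(?f has_integral (F a + (q - F a) / (p - a) * (y - a))) {0..y}" if "a \<le> y" "y \<le> p" for y
    by (rule has_integral_combine[OF _ _ A has_integral_step])
       (use that o in \<open>auto simp: bend_density_def\<close>)
  have Bp: "(?f has_integral q) {0..p}"
    using B[of p] o by simp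
  have C: "(?f has_integral (q + (F b - q) / (b - p) * (y - p))) {0..y}" if "p \<le> y" "y \<le> b" for y
    by (rule has_integral_combine[OF _ _ Bp has_integral_step])
       (use that o in \<open>auto simp: bend_density_def\<close>)
  have Cb: "(?f has_integral F b) {0..b}"
    using C[of b] o by simp
  have D: "(?f has_integral F y) {0..y}" if "b \<le> y" for y
  proof -
    have "(?f has_integral (F y - F b)) {b..y}"
    proof (rule has_integral_spike_finite[of "{b}"])
      show "(f has_integral (F y - F b)) {b..y}"
        by (rule has_cdf_has_integral[OF F]) (use o that in auto)
    qed (use o that in \<open>auto simp: bend_density_def\<close>)
    from has_integral_combine[OF _ _ Cb this] show ?thesis using o that by simp
  qed
  have "\<forall>y\<ge>0. (?f has_integral ?G y) {0..y}"
  proof (intro allI impI)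
    fix y :: real assume "0 \<le> y"
    thus "(?f has_integral ?G y) {0..y}"
      using A[of y] B[of y] C[of y] D[of y] by (auto simp: bend_def)
  qed
  with neg nn one show ?thesis by (simp add: has_cdf_def)
qed

text \<open>The seed: all concrete distribution functions below arise from this one by repeated
  bending.\<close>

lemma has_cdf_uniform:
  "has_cdf (\<lambda>x. if 0 \<le> x \<and> x \<le> 1 then 1 else 0) (\<lambda>x. max 0 (min x 1))" (is "has_cdf ?f ?F")
proof -
  have A: "(?f has_integral y) {0..y}" if "0 \<le> y" "y \<le> 1" for y :: real
    using has_integral_step[of 0 y ?f 1] that by simp
  have "(?f has_integral 1) {0..y}" if "1 \<le> y" for y :: real
    using has_integral_combine[OF _ _ A[of 1] has_integral_step[of 1 y ?f 0]] that by simp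
  thus ?thesis using A by (auto simp: has_cdf_def max_def min_def)
qed

lemma bend_outside: "x \<le> a \<or> b \<le> x \<Longrightarrow> bend a p b q F x = F x"
  by (simp add: bend_def)

lemma bend_first:
  assumes "a < p" "p < b" "a \<le> x" "x \<le> p"
  shows "bend a p b q F x = F a + (q - F a) / (p - a) * (x - a)"
  using assms by (cases "x = a") (auto simp: bend_def)

lemma bend_second:
  assumes "a < p" "p < b" "p \<le> x" "x \<le> b"
  shows "bend a p b q F x = q + (F b - q) / (b - p) * (x - p)"
proof -
  consider "x = p" | "x = b" | "p < x" "x < b" using assms by linarith
  thus ?thesis using assms by cases (auto simp: bend_def)
qed

lemma bend_at:
  assumes "a < p" "p < b"
  shows "bend a p b q F p = q"
  using assms by (simp add: bend_def)

section \<open>Refining the functions of players 1 and 2\<close>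

definition player_cdf :: "real \<Rightarrow> real \<Rightarrow> (real \<Rightarrow> real) \<Rightarrow> (real \<Rightarrow> real) \<Rightarrow> bool" where
  "player_cdf \<eta> c f F \<longleftrightarrow>
     has_cdf f F \<and> (\<forall>x\<in>{0..1}. \<eta> \<le> f x) \<and> (\<forall>x\<in>{3/8..3/4}. c \<le> f x)"

text \<open>Positive density makes preimages unique, so that cut answers do not depend on how a
  \<open>cut_rule\<close> breaks ties.\<close>

lemma player_cdf_strict_mono:
  assumes "player_cdf \<eta> c f F" "0 < \<eta>" "0 \<le> x" "x < y" "y \<le> 1"
  shows "F x < F y"
proof -
  have "\<eta> * (y - x) \<le> F y - F x"
    by (rule has_cdf_slope) (use assms in \<open>auto simp: player_cdf_def\<close>)
  moreover have "0 < \<eta> * (y - x)" using assms by simp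
  ultimately show ?thesis by linarith
qed

text \<open>The graph of \<open>F\<close> passes through two opposite corners and the centre of a square (in units of
  the slope \<open>4/3\<close>). Along \<open>y = 2x\<close>, a player is indifferent iff \<open>F y\<close> has the value
  \<open>2/3 - \<kappa> + m * \<tau>\<close> at \<open>y = 1/2 + \<tau>\<close>, with \<open>m = 1/3\<close> for player 1 and \<open>m = -2/3\<close> for player 2.\<close>

definition node :: "real \<Rightarrow> real \<Rightarrow> real \<Rightarrow> real \<Rightarrow> (real \<Rightarrow> real) \<Rightarrow> bool" where
  "node \<kappa> m \<tau> r F \<longleftrightarrow>
     F (1 / 2 + \<tau> - r) = 2 / 3 - \<kappa> + m * \<tau> - 4 * r / 3 \<and>
     F (1 / 2 + \<tau>) = 2 / 3 - \<kappa> + m * \<tau> \<and>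
     F (1 / 2 + \<tau> + r) = 2 / 3 - \<kappa> + m * \<tau> + 4 * r / 3"

definition agree_outside :: "real \<Rightarrow> real \<Rightarrow> (real \<Rightarrow> real) \<Rightarrow> (real \<Rightarrow> real) \<Rightarrow> bool" where
  "agree_outside \<tau> r F G \<longleftrightarrow> (\<forall>x. x \<le> 1 / 2 + \<tau> - r \<or> 1 / 2 + \<tau> + r \<le> x \<longrightarrow> G x = F x)"

lemma agree_outside_trans:
  assumes "agree_outside \<tau> r F G" "agree_outside \<tau>' r' G H" "\<bar>\<tau>' - \<tau>\<bar> + r' \<le> r"
  shows "agree_outside \<tau> r F H"
  unfolding agree_outside_def
proof (intro allI impI)
  fix x assume x: "x \<le> 1 / 2 + \<tau> - r \<or> 1 / 2 + \<tau> + r \<le> x"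
  hence "x \<le> 1 / 2 + \<tau>' - r' \<or> 1 / 2 + \<tau>' + r' \<le> x" using assms(3) by linarith
  thus "H x = F x" using x assms unfolding agree_outside_def by metis
qed

lemma agree_outside_refl: "agree_outside \<tau> r F F"
  by (simp add: agree_outside_def)

text \<open>Inside the old window the graph is replaced by three segments, the middle one being the
  diagonal, of slope 4/3, of the new square. In units of \<open>r\<close> the outer ones run 7/8
  \<plusminus> \<sigma>/2 to the side and 7/6 \<plusminus> m * \<sigma>/2 up. Their smallest slope
  is 32/33 for m = 1/3 and 20/33 for m = -2/3, which leaves room for the values 9/10 and 3/5 of
  \<open>c\<close>.\<close>

lemma node_child:
  assumes pc: "player_cdf \<eta> c f F" and nd: "node \<kappa> m \<tau> r F"
    and r: "0 < r" "\<bar>\<tau>\<bar> + r \<le> 1 / 16" and \<sigma>: "\<sigma> = 1 \<or> \<sigma> = - 1"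
    and mc: "m = 1 / 3 \<and> c = 9 / 10 \<or> m = - (2 / 3) \<and> c = 3 / 5" and \<eta>: "\<eta> \<le> 3 / 5"
  shows "\<exists>f' F'. player_cdf \<eta> c f' F' \<and> node \<kappa> m (\<tau> + \<sigma> * r / 2) (r / 8) F' \<and>
    agree_outside \<tau> r F F'"
proof -
  define A where "A = 1 / 2 + \<tau> - r"
  define B where "B = 1 / 2 + \<tau> + r"
  define u where "u = 1 / 2 + (\<tau> + \<sigma> * r / 2)"
  define p1 where "p1 = u - r / 8"
  define p2 where "p2 = u + r / 8"
  define w where "w = 2 / 3 - \<kappa> + m * (\<tau> + \<sigma> * r / 2)"
  define q1 where "q1 = w - 4 * (r / 8) / 3"
  define q2 where "q2 = w + 4 * (r / 8) / 3"
  have FA: "F A = 2 / 3 - \<kappa> + m * \<tau> - 4 * r / 3" and FB: "F B = 2 / 3 - \<kappa> + m * \<tau> + 4 * r / 3"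
    using nd unfolding node_def A_def B_def by auto
  have o: "A < p1" "p1 < u" "u < p2" "p2 < B" "0 < A" "B < 1"
    using \<sigma> r by (auto simp: A_def B_def u_def p1_def p2_def)
  have "p1 - A = r * (7 / 8 + \<sigma> / 2)" "q1 - F A = r * (7 / 6 + m * \<sigma> / 2)"
    "B - p2 = r * (7 / 8 - \<sigma> / 2)" "F B - q2 = r * (7 / 6 - m * \<sigma> / 2)"
    by (unfold FA FB) (auto simp: q1_def q2_def w_def p1_def p2_def u_def A_def B_def field_simps)
  moreover have "c * (7 / 8 + \<sigma> / 2) \<le> 7 / 6 + m * \<sigma> / 2" "c * (7 / 8 - \<sigma> / 2) \<le> 7 / 6 - m * \<sigma> / 2"
    using mc \<sigma> by (elim disjE conjE; simp)+
  ultimately have s1: "c * (p1 - A) \<le> q1 - F A" and s3: "c * (B - p2) \<le> F B - q2"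
    using r(1) by (simp_all add: mult.left_commute mult_left_mono)
  have c: "0 < c" "c \<le> 4 / 3" "\<eta> \<le> c" using mc \<eta> by auto
  have q: "F A \<le> q1" "q1 \<le> q2" "q2 \<le> F B"
  proof -
    show "F A \<le> q1" using s1 mult_pos_pos[OF c(1), of "p1 - A"] o by linarith
    show "q2 \<le> F B" using s3 mult_pos_pos[OF c(1), of "B - p2"] o by linarith
    show "q1 \<le> q2" using r by (simp add: q1_def q2_def)
  qed
  \<comment> \<open>Two bends make three segments: the first puts a corner at \<open>p1\<close>, the
    second splits the remainder from \<open>p1\<close> to \<open>B\<close> at
    \<open>p2\<close>.\<close>
  define F1 where "F1 = bend A p1 B q1 F"
  define f1 where "f1 = bend_density A p1 B q1 F f"
  define F2 where "F2 = bend p1 p2 B q2 F1"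
  define f2 where "f2 = bend_density p1 p2 B q2 F1 f1"
  have cdf: "has_cdf f F" using pc by (simp add: player_cdf_def)
  have cdf1: "has_cdf f1 F1" unfolding F1_def f1_def
    by (rule has_cdf_bend[OF cdf]) (use o q in auto)
  have F1p: "F1 p1 = q1" and F1B: "F1 B = F B"
    using o by (auto simp: F1_def bend_at bend_outside)
  have cdf2: "has_cdf f2 F2" unfolding F2_def f2_def
    by (rule has_cdf_bend[OF cdf1]) (use o q F1p F1B in auto)
  have slope1: "c \<le> (q1 - F A) / (p1 - A)" using s1 o by (simp add: pos_le_divide_eq)
  have slope3: "c \<le> (F B - q2) / (B - p2)" using s3 o by (simp add: pos_le_divide_eq)
  have slope2: "(q2 - q1) / (p2 - p1) = 4 / 3"
    using r by (simp add: q1_def q2_def p1_def p2_def field_simps)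
  have slope2': "c \<le> (q2 - q1) / (p2 - p1)" unfolding slope2 by (rule c(2))
  have f2: "f2 x = f x \<or> c \<le> f2 x" for x
    using slope1 slope2' slope3 o
    by (auto simp: f2_def f1_def bend_density_def F1p F1B)
  have "player_cdf \<eta> c f2 F2"
    using pc cdf2 f2 c unfolding player_cdf_def by (metis order_trans)
  moreover have "node \<kappa> m (\<tau> + \<sigma> * r / 2) (r / 8) F2"
  proof -
    have "F2 p1 = q1" using F1p by (simp add: F2_def bend_outside)
    moreover have "F2 p2 = q2" using o by (simp add: F2_def bend_at)
    moreover have "F2 u = w"
    proof -
      have "F2 u = q1 + (q2 - q1) / (p2 - p1) * (u - p1)"
        using bend_first[of p1 p2 B u q2 F1] o F1p by (simp add: F2_def)
      thus ?thesis unfolding slope2 by (simp add: q1_def p1_def)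
    qed
    ultimately show ?thesis
      by (simp add: node_def p1_def p2_def q1_def q2_def w_def u_def)
  qed
  moreover have "agree_outside \<tau> r F F2"
    unfolding agree_outside_def A_def[symmetric] B_def[symmetric]
  proof (intro allI impI)
    fix x assume "x \<le> A \<or> B \<le> x"
    hence "F2 x = F1 x" "F1 x = F x" using o by (auto simp: F2_def F1_def bend_outside)
    thus "F2 x = F x" by simp
  qed
  ultimately show ?thesis by blast
qed

section \<open>Explicit distribution functions of the players\<close>

lemma has_cdf_extend:
  assumes F: "has_cdf f F" and p: "0 \<le> p'" "p' < p" "p < 1" and q: "F p' \<le> q" "q \<le> 1"
  shows "\<exists>f' F'. has_cdf f' F' \<and> (\<forall>x\<le>p'. F' x = F x \<and> f' x = f x) \<and>
    (\<forall>x. p' \<le> x \<and> x \<le> p \<longrightarrow> F' x = F p' + (q - F p') / (p - p') * (x - p')) \<and>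
    (\<forall>x. p \<le> x \<and> x \<le> 1 \<longrightarrow> F' x = q + (1 - q) / (1 - p) * (x - p)) \<and>
    (\<forall>x. p' < x \<and> x \<le> p \<longrightarrow> f' x = (q - F p') / (p - p')) \<and>
    (\<forall>x. p < x \<and> x \<le> 1 \<longrightarrow> f' x = (1 - q) / (1 - p)) \<and> F' p = q"
proof -
  have F1: "F 1 = 1" by (rule has_cdf_1[OF F])
  have "has_cdf (bend_density p' p 1 q F f) (bend p' p 1 q F)"
    by (rule has_cdf_bend[OF F]) (use p q F1 in auto)
  moreover have "\<forall>x. p' \<le> x \<and> x \<le> p \<longrightarrow> bend p' p 1 q F x = F p' + (q - F p') / (p - p') * (x - p')"
    using p by (blast intro: bend_first less_trans)
  moreover have "\<forall>x. p \<le> x \<and> x \<le> 1 \<longrightarrow> bend p' p 1 q F x = q + (1 - q) / (1 - p) * (x - p)"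
    using p F1 by (auto simp: bend_second)
  ultimately show ?thesis using p F1
    by (intro exI[of _ "bend_density p' p 1 q F f"] exI[of _ "bend p' p 1 q F"])
       (auto simp: bend_outside bend_density_def bend_at)
qed

text \<open>The offset \<open>k\<close> is \<open>-2\<kappa>\<close> for player 1 and \<open>\<kappa>\<close> for player 2: it makes the left, respectively the
  middle, piece the one that the player dislikes.\<close>

definition shape :: "real \<Rightarrow> real \<Rightarrow> real \<Rightarrow> real \<Rightarrow> (real \<Rightarrow> real) \<Rightarrow> bool" where
  "shape k \<kappa> \<delta> \<eta> F \<longleftrightarrow>
     (\<forall>x. 1 / 8 \<le> x \<and> x \<le> 3 / 8 \<longrightarrow> F x = 4 * x / 3 + k) \<and>
     (\<forall>y. 7 / 16 \<le> y \<and> y \<le> 9 / 16 \<and> \<delta> \<le> \<bar>y - 1 / 2\<bar> \<longrightarrow> F y = 4 * y / 3 - \<kappa>) \<and>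
     (\<forall>x. 0 \<le> x \<and> x \<le> 1 \<and> \<delta> \<le> \<bar>x - 1 / 2\<bar> \<longrightarrow> \<bar>F x - min (4 * x / 3) 1\<bar> \<le> 3 * \<kappa>) \<and>
     F (3 / 4) = 1 - \<eta>"

text \<open>The clauses of \<open>shape\<close> read the function only at distance at least \<delta>
  from 1/2, where a refinement changes nothing. The points up to 3/8 and the point 3/4 are that far
  away because \<delta> \<le> 1/16.\<close>

lemma shape_agree:
  assumes "shape k \<kappa> \<delta> \<eta> F" "agree_outside \<tau> r F G" "\<bar>\<tau>\<bar> + r \<le> \<delta>" "\<delta> \<le> 1 / 16"
  shows "shape k \<kappa> \<delta> \<eta> G"
proof -
  have eq: "G x = F x" if "\<delta> \<le> \<bar>x - 1 / 2\<bar>" for x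
  proof -
    have "x \<le> 1 / 2 + \<tau> - r \<or> 1 / 2 + \<tau> + r \<le> x" using that assms(3) by linarith
    thus ?thesis using assms(2) unfolding agree_outside_def by blast
  qed
  have "G x = F x" if "x \<le> 3 / 8 \<or> x = 3 / 4" for x
    using that assms(4) by (intro eq) linarith
  hence "G (3 / 4) = F (3 / 4)" "\<And>x. x \<le> 3 / 8 \<Longrightarrow> G x = F x" by blast+
  with eq assms(1) show ?thesis unfolding shape_def by simp
qed

text \<open>On a linear segment the deviation from 4x/3 is a convex combination of the deviations at
  the two ends.\<close>

lemma interpolation_bound:
  fixes c :: real
  assumes "\<And>x. p \<le> x \<and> x \<le> p' \<Longrightarrow> F x = q + (q' - q) / (p' - p) * (x - p)"
    and "p < p'" "p \<le> x" "x \<le> p'" "\<bar>q - 4 * p / 3\<bar> \<le> c" "\<bar>q' - 4 * p' / 3\<bar> \<le> c"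
  shows "\<bar>F x - 4 * x / 3\<bar> \<le> c"
proof -
  define l where "l = (x - p) / (p' - p)"
  have l: "0 \<le> l" "l \<le> 1" using assms by (auto simp: l_def)
  have x: "x = p + l * (p' - p)" using assms by (simp add: l_def)
  have "F x = q + (q' - q) * l" using assms by (simp add: l_def)
  hence "F x - 4 * x / 3 = q + (q' - q) * l - 4 * (p + l * (p' - p)) / 3"
    using x by simp
  also have "\<dots> = (1 - l) * (q - 4 * p / 3) + l * (q' - 4 * p' / 3)"
    by (simp add: field_simps)
  also have "\<bar>\<dots>\<bar> \<le> (1 - l) * \<bar>q - 4 * p / 3\<bar> + l * \<bar>q' - 4 * p' / 3\<bar>"
    using l by (intro order_trans[OF abs_triangle_ineq]) (simp add: abs_mult)
  also have "\<dots> \<le> (1 - l) * c + l * c"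
    using l assms by (intro add_mono mult_left_mono) auto
  finally show ?thesis by (simp add: algebra_simps)
qed

lemma root_player:
  assumes k: "k = - 2 * \<kappa> \<or> k = \<kappa>" and \<kappa>: "0 < \<kappa>" "\<kappa> \<le> 1 / 1000" and \<delta>: "0 < \<delta>" "\<delta> \<le> 1 / 16"
    and \<eta>: "0 < \<eta>" "\<eta> \<le> \<kappa>" and c: "c \<le> 9 / 10"
  shows "\<exists>f F. player_cdf \<eta> c f F \<and> shape k \<kappa> \<delta> \<eta> F \<and> node \<kappa> m 0 \<delta> F"
proof -
  let ?U = "\<lambda>x::real. max 0 (min x 1)"
  \<comment> \<open>The graph is built from left to right, and each extension overwrites the
    provisional last segment to (1, 1). The corners have height 4x/3 + k at 1/8 and 3/8, 4x/3 -
    \<kappa> at 7/16 and 9/16, and 1 - \<eta> at 3/4. At 0 the uniform density 1 survives, since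
    bends leave their left end alone.\<close>
  obtain f1 F1 where 1: "has_cdf f1 F1"
    and F1: "\<And>x. 0 \<le> x \<and> x \<le> 1/8 \<Longrightarrow> F1 x = 0 + ((1/6 + k) - 0) / (1/8 - 0) * (x - 0)"
    and f1: "f1 0 = 1" "\<And>x. 0 < x \<and> x \<le> 1/8 \<Longrightarrow> f1 x = (1/6 + k) * 8"
    and e1: "F1 (1/8) = 1/6 + k"
    using has_cdf_extend[OF has_cdf_uniform, of 0 "1/8" "1/6 + k"] k \<kappa> by auto
  obtain f2 F2 where 2: "has_cdf f2 F2"
    and p2: "\<And>x. x \<le> 1/8 \<Longrightarrow> F2 x = F1 x \<and> f2 x = f1 x"
    and F2: "\<And>x. 1/8 \<le> x \<and> x \<le> 3/8 \<Longrightarrow> F2 x = (1/6 + k) + ((1/2 + k) - (1/6 + k)) / (3/8 - 1/8) * (x - 1/8)"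
    and f2: "\<And>x. 1/8 < x \<and> x \<le> 3/8 \<Longrightarrow> f2 x = 4/3"
    and e2: "F2 (3/8) = 1/2 + k"
    using has_cdf_extend[OF 1, of "1/8" "3/8" "1/2 + k"] k \<kappa> unfolding e1 by auto
  obtain f3 F3 where 3: "has_cdf f3 F3"
    and p3: "\<And>x. x \<le> 3/8 \<Longrightarrow> F3 x = F2 x \<and> f3 x = f2 x"
    and F3: "\<And>x. 3/8 \<le> x \<and> x \<le> 7/16 \<Longrightarrow> F3 x = (1/2 + k) + ((7/12 - \<kappa>) - (1/2 + k)) / (7/16 - 3/8) * (x - 3/8)"
    and f3: "\<And>x. 3/8 < x \<and> x \<le> 7/16 \<Longrightarrow> f3 x = (1/12 - \<kappa> - k) * 16"
    and e3: "F3 (7/16) = 7/12 - \<kappa>"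
    using has_cdf_extend[OF 2, of "3/8" "7/16" "7/12 - \<kappa>"] k \<kappa> unfolding e2 by auto
  obtain f4 F4 where 4: "has_cdf f4 F4"
    and p4: "\<And>x. x \<le> 7/16 \<Longrightarrow> F4 x = F3 x \<and> f4 x = f3 x"
    and F4: "\<And>x. 7/16 \<le> x \<and> x \<le> 9/16 \<Longrightarrow> F4 x = (7/12 - \<kappa>) + ((3/4 - \<kappa>) - (7/12 - \<kappa>)) / (9/16 - 7/16) * (x - 7/16)"
    and f4: "\<And>x. 7/16 < x \<and> x \<le> 9/16 \<Longrightarrow> f4 x = 4/3"
    and e4: "F4 (9/16) = 3/4 - \<kappa>"
    using has_cdf_extend[OF 3, of "7/16" "9/16" "3/4 - \<kappa>"] k \<kappa> unfolding e3 by auto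
  obtain f5 F5 where 5: "has_cdf f5 F5"
    and p5: "\<And>x. x \<le> 9/16 \<Longrightarrow> F5 x = F4 x \<and> f5 x = f4 x"
    and F5: "\<And>x. 9/16 \<le> x \<and> x \<le> 3/4 \<Longrightarrow> F5 x = (3/4 - \<kappa>) + ((1 - \<eta>) - (3/4 - \<kappa>)) / (3/4 - 9/16) * (x - 9/16)"
    and f5: "\<And>x. 9/16 < x \<and> x \<le> 3/4 \<Longrightarrow> f5 x = (1/4 + \<kappa> - \<eta>) * 16 / 3"
      "\<And>x. 3/4 < x \<and> x \<le> 1 \<Longrightarrow> f5 x = 4 * \<eta>"
    and e5: "F5 (3/4) = 1 - \<eta>"
    using has_cdf_extend[OF 4, of "9/16" "3/4" "1 - \<eta>"] k \<kappa> \<eta> unfolding e4 by auto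
  have dens: "f5 x = 4 * \<eta> \<and> 3/4 < x \<or> c \<le> f5 x" if "0 \<le> x" "x \<le> 1" for x
  proof -
    consider "x = 0" | "0 < x" "x \<le> 1/8" | "1/8 < x" "x \<le> 3/8" | "3/8 < x" "x \<le> 7/16"
      | "7/16 < x" "x \<le> 9/16" | "9/16 < x" "x \<le> 3/4" | "3/4 < x" using \<open>0 \<le> x\<close> by linarith
    thus ?thesis
      using that p5[of x] p4[of x] p3[of x] p2[of x] f1 f2[of x] f3[of x] f4[of x] f5[of x] k \<kappa> \<eta> c
      by cases auto
  qed
  have "player_cdf \<eta> c f5 F5"
    unfolding player_cdf_def
  proof (intro conjI ballI)
    fix x :: real assume x: "x \<in> {0..1}"
    show "\<eta> \<le> f5 x"
    proof -
      consider "x = 0" | "0 < x" "x \<le> 1/8" | "1/8 < x" "x \<le> 3/8" | "3/8 < x" "x \<le> 7/16"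
        | "7/16 < x" "x \<le> 9/16" | "9/16 < x" "x \<le> 3/4" | "3/4 < x" using x by force
      thus ?thesis
        using x p5[of x] p4[of x] p3[of x] p2[of x] f1 f2[of x] f3[of x] f4[of x] f5[of x] k \<kappa> \<eta>
        by cases auto
    qed
  next
    fix x :: real assume "x \<in> {3/8..3/4}"
    thus "c \<le> f5 x" using dens[of x] by auto
  qed (rule 5)
  moreover have mid: "F5 y = 4 * y / 3 - \<kappa>" if "7/16 \<le> y" "y \<le> 9/16" for y
    using that F4[of y] p5[of y] by (simp add: field_simps)
  moreover have "shape k \<kappa> \<delta> \<eta> F5"
    unfolding shape_def
  proof (intro conjI allI impI; (elim conjE)?)
    fix x :: real assume "1 / 8 \<le> x" "x \<le> 3 / 8"
    thus "F5 x = 4 * x / 3 + k" using p5[of x] p4[of x] p3[of x] F2[of x] by (simp add: field_simps)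
  next
    fix x :: real assume x: "0 \<le> x" "x \<le> 1"
    have r1: "F5 x = F1 x" if "0 \<le> x \<and> x \<le> 1/8" for x using that p5[of x] p4[of x] p3[of x] p2[of x] by auto
    have r2: "F5 x = F2 x" if "1/8 \<le> x \<and> x \<le> 3/8" for x using that p5[of x] p4[of x] p3[of x] by auto
    have r3: "F5 x = F3 x" if "3/8 \<le> x \<and> x \<le> 7/16" for x using that p5[of x] p4[of x] by auto
    have r4: "F5 x = F4 x" if "7/16 \<le> x \<and> x \<le> 9/16" for x using that p5[of x] by auto
    have bnd: "\<bar>F5 x - 4 * x / 3\<bar> \<le> 3 * \<kappa>" if "x \<le> 3/4"
    proof -
      consider "x \<le> 1/8" | "1/8 \<le> x" "x \<le> 3/8" | "3/8 \<le> x" "x \<le> 7/16"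
        | "7/16 \<le> x" "x \<le> 9/16" | "9/16 \<le> x" by linarith
      thus ?thesis
      proof cases
        case 1
        show ?thesis by (rule interpolation_bound[OF trans[OF r1 F1]]) (use 1 x k \<kappa> in auto)
      next
        case 2
        show ?thesis by (rule interpolation_bound[OF trans[OF r2 F2]]) (use 2 x k \<kappa> in auto)
      next
        case 3
        show ?thesis by (rule interpolation_bound[OF trans[OF r3 F3]]) (use 3 x k \<kappa> in auto)
      next
        case 4
        show ?thesis by (rule interpolation_bound[OF trans[OF r4 F4]]) (use 4 x k \<kappa> in auto)
      next
        case 5
        show ?thesis by (rule interpolation_bound[OF F5]) (use 5 x that \<kappa> \<eta> in auto)
      qed
    qed
    show "\<bar>F5 x - min (4 * x / 3) 1\<bar> \<le> 3 * \<kappa>"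
    proof (cases "x \<le> 3/4")
      case True
      thus ?thesis using bnd by simp
    next
      case False
      hence "1 - \<eta> \<le> F5 x" "F5 x \<le> 1"
        using has_cdf_mono[OF 5, of "3/4" x] has_cdf_mono[OF 5, of x 1] has_cdf_1[OF 5] e5 x by auto
      thus ?thesis using False \<eta> \<kappa> by auto
    qed
  qed (use mid e5 in auto)
  moreover have "node \<kappa> m 0 \<delta> F5"
    unfolding node_def using mid[of "1/2 - \<delta>"] mid[of "1/2"] mid[of "1/2 + \<delta>"] \<delta> by auto
  ultimately show ?thesis by blast
qed

text \<open>The gap between 1/2 + \<delta> and 3/4 leaves a right piece that starts near 1/2 with
  hardly any value outside the tail, so that player 3 effectively compares the left and the middle
  piece. Scaling by \<sigma> + q keeps the normalising factor out of the later estimates.\<close>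

lemma third_player:
  fixes q \<delta> :: real
  assumes q: "0 < q" and \<delta>: "0 < \<delta>" "\<delta> \<le> 1 / 16"
  defines "\<sigma> \<equiv> 4 / 3 * (1 / 2 + \<delta>)"
  shows "\<exists>f F. has_cdf f F \<and>
    (\<forall>x. 0 \<le> x \<and> x \<le> 3 / 4 \<longrightarrow> (\<sigma> + q) * F x = 4 / 3 * min x (1 / 2 + \<delta>)) \<and>
    (\<forall>x. 3 / 4 \<le> x \<and> x \<le> 1 \<longrightarrow> (\<sigma> + q) * F x = \<sigma> + q * (4 * x - 3))"
proof -
  have \<sigma>: "0 < \<sigma>" using \<delta> by (simp add: \<sigma>_def)
  define w where "w = \<sigma> / (\<sigma> + q)"
  have w: "0 \<le> w" "w \<le> 1" "(\<sigma> + q) * w = \<sigma>" using \<sigma> q by (auto simp: w_def)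
  obtain f1 F1 where 1: "has_cdf f1 F1"
    and F1: "\<And>x. 0 \<le> x \<and> x \<le> 1/2 + \<delta> \<Longrightarrow> F1 x = w / (1/2 + \<delta>) * x"
    and e1: "F1 (1/2 + \<delta>) = w"
    using has_cdf_extend[OF has_cdf_uniform, of 0 "1/2 + \<delta>" w] \<delta> w by auto
  obtain f2 F2 where 2: "has_cdf f2 F2"
    and p2: "\<And>x. x \<le> 1/2 + \<delta> \<Longrightarrow> F2 x = F1 x"
    and F2: "\<And>x. 1/2 + \<delta> \<le> x \<and> x \<le> 3/4 \<Longrightarrow> F2 x = w"
    and F2': "\<And>x. 3/4 \<le> x \<and> x \<le> 1 \<Longrightarrow> F2 x = w + (1 - w) / (1 - 3/4) * (x - 3/4)"
    using has_cdf_extend[OF 1, of "1/2 + \<delta>" "3/4" w] \<delta> w unfolding e1 by auto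
  have "(\<sigma> + q) * F2 x = 4 / 3 * min x (1 / 2 + \<delta>)" if x: "0 \<le> x" "x \<le> 3/4" for x
  proof (cases "x \<le> 1/2 + \<delta>")
    case True
    hence "(\<sigma> + q) * F2 x = ((\<sigma> + q) * w) / (1/2 + \<delta>) * x" using p2 F1 x by simp
    also have "(\<sigma> + q) * w / (1/2 + \<delta>) = 4 / 3"
      unfolding w(3) unfolding \<sigma>_def by (rule nonzero_mult_div_cancel_right) (use \<delta> in auto)
    finally show ?thesis using True by simp
  next
    case False
    thus ?thesis using F2[of x] x w(3) by (simp add: \<sigma>_def)
  qed
  moreover have "(\<sigma> + q) * F2 x = \<sigma> + q * (4 * x - 3)" if x: "3/4 \<le> x" "x \<le> 1" for x
  proof -
    have "(\<sigma> + q) * F2 x = (\<sigma> + q) * w + ((\<sigma> + q) - (\<sigma> + q) * w) * (4 * x - 3)"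
      unfolding F2'[OF conjI[OF x]] by (simp add: algebra_simps)
    thus ?thesis using w(3) by simp
  qed
  ultimately show ?thesis using 2 by blast
qed

lemma last_players:
  "\<exists>g N. has_cdf g N \<and> (\<forall>x\<le>3/4. N x = 0) \<and> (\<forall>x. 3 / 4 \<le> x \<and> x \<le> 1 \<longrightarrow> N x = 4 * x - 3)"
proof -
  obtain g N where 1: "has_cdf g N"
    and N: "\<And>x. 0 \<le> x \<and> x \<le> 3/4 \<Longrightarrow> N x = 0" "\<And>x. 3/4 \<le> x \<and> x \<le> 1 \<Longrightarrow> N x = 4 * x - 3"
    using has_cdf_extend[OF has_cdf_uniform, of 0 "3/4" 0] by auto
  have "N x = 0" if "x \<le> 3/4" for x
    using that 1 N unfolding has_cdf_def by (cases "x < 0") auto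
  thus ?thesis using 1 N by blast
qed

section \<open>Rigidity of the cuts\<close>

definition takes_left :: "(real \<Rightarrow> real) \<Rightarrow> real \<Rightarrow> real \<Rightarrow> real \<Rightarrow> real \<Rightarrow> bool" where
  "takes_left F s x y t \<longleftrightarrow> F x \<ge> F y - F x - s \<and> F x \<ge> F t - F y - s"

definition takes_middle :: "(real \<Rightarrow> real) \<Rightarrow> real \<Rightarrow> real \<Rightarrow> real \<Rightarrow> real \<Rightarrow> bool" where
  "takes_middle F s x y t \<longleftrightarrow> F y - F x \<ge> F x - s \<and> F y - F x \<ge> F t - F y - s"

definition takes_right :: "(real \<Rightarrow> real) \<Rightarrow> real \<Rightarrow> real \<Rightarrow> real \<Rightarrow> real \<Rightarrow> bool" where
  "takes_right F s x y t \<longleftrightarrow> F t - F y \<ge> F x - s \<and> F t - F y \<ge> F y - F x - s"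

text \<open>\<open>D\<close> is the distribution function of player 3, scaled so that it has the same slope \<open>4/3\<close> as
  those of the players 1 and 2.\<close>

locale rigid_cdfs =
  fixes F1 F2 D :: "real \<Rightarrow> real" and \<kappa> \<delta> s \<omega> \<tau> :: real
  assumes const: "0 < s" "100 * s \<le> \<kappa>" "0 < \<delta>" "10 * \<delta> \<le> \<kappa>" "200 * \<kappa> \<le> \<omega>" "\<omega> \<le> 1 / 18"
    and near1: "0 \<le> x \<Longrightarrow> x \<le> 1 \<Longrightarrow> \<bar>F1 x - min (4 * x / 3) 1\<bar> \<le> 3 * \<kappa>"
    and near2: "0 \<le> x \<Longrightarrow> x \<le> 1 \<Longrightarrow> \<bar>F2 x - min (4 * x / 3) 1\<bar> \<le> 3 * \<kappa>"
    and top1: "3 / 4 \<le> x \<Longrightarrow> x \<le> 1 \<Longrightarrow> 1 - s \<le> F1 x \<and> F1 x \<le> 1"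
    and top2: "3 / 4 \<le> x \<Longrightarrow> x \<le> 1 \<Longrightarrow> 1 - s \<le> F2 x \<and> F2 x \<le> 1"
    and low1: "1 / 8 \<le> x \<Longrightarrow> x \<le> 3 / 8 \<Longrightarrow> F1 x = 4 * x / 3 - 2 * \<kappa>"
    and low2: "1 / 8 \<le> x \<Longrightarrow> x \<le> 3 / 8 \<Longrightarrow> F2 x = 4 * x / 3 + \<kappa>"
    and high1: "7 / 16 \<le> y \<Longrightarrow> y \<le> 9 / 16 \<Longrightarrow> \<delta> \<le> \<bar>y - 1 / 2\<bar> \<Longrightarrow> F1 y = 4 * y / 3 - \<kappa>"
    and high2: "7 / 16 \<le> y \<Longrightarrow> y \<le> 9 / 16 \<Longrightarrow> \<delta> \<le> \<bar>y - 1 / 2\<bar> \<Longrightarrow> F2 y = 4 * y / 3 - \<kappa>"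
    and steep1: "3 / 8 \<le> x \<Longrightarrow> x \<le> y \<Longrightarrow> y \<le> 3 / 4 \<Longrightarrow> 9 / 10 * (y - x) \<le> F1 y - F1 x"
    and steep2: "3 / 8 \<le> x \<Longrightarrow> x \<le> y \<Longrightarrow> y \<le> 3 / 4 \<Longrightarrow> 3 / 5 * (y - x) \<le> F2 y - F2 x"
    and tau: "\<bar>\<tau>\<bar> \<le> \<delta>"
    and mid1: "F1 (1 / 2 + \<tau>) = 2 / 3 - \<kappa> + \<tau> / 3"
    and mid2: "F2 (1 / 2 + \<tau>) = 2 / 3 - \<kappa> - 2 * \<tau> / 3"
    and D: "0 \<le> x \<Longrightarrow> x \<le> 3 / 4 \<Longrightarrow> D x = 4 / 3 * min x (1 / 2 + \<delta>)"
begin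

lemma F_mono:
  assumes "3 / 8 \<le> x" "x \<le> y" "y \<le> 3 / 4"
  shows "F1 x \<le> F1 y" and "F2 x \<le> F2 y"
  using steep1[OF assms] steep2[OF assms] assms by simp_all

text \<open>Within \<delta> of 1/2 both functions are monotone between the same two values at 1/2
  \<plusminus> \<delta>, whose distance 8\<delta>/3 is below \<kappa>/2. Elsewhere they
  coincide.\<close>

lemma F1_close_F2:
  assumes "7 / 16 \<le> y" "y \<le> 9 / 16"
  shows "\<bar>F1 y - F2 y\<bar> \<le> \<kappa> / 2"
proof (cases "\<delta> \<le> \<bar>y - 1 / 2\<bar>")
  case True
  thus ?thesis using assms high1 high2 const by simp
next
  case False
  have d: "\<delta> \<le> 1 / 16" "0 < \<delta>" "8 * \<delta> / 3 \<le> \<kappa> / 2" using const by linarith+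
  have "F1 (1/2 - \<delta>) = 4 * (1/2 - \<delta>) / 3 - \<kappa>" "F1 (1/2 + \<delta>) = 4 * (1/2 + \<delta>) / 3 - \<kappa>"
    "F2 (1/2 - \<delta>) = 4 * (1/2 - \<delta>) / 3 - \<kappa>" "F2 (1/2 + \<delta>) = 4 * (1/2 + \<delta>) / 3 - \<kappa>"
    using d by (intro high1 high2; simp)+
  moreover have "F1 (1/2 - \<delta>) \<le> F1 y" "F1 y \<le> F1 (1/2 + \<delta>)"
    "F2 (1/2 - \<delta>) \<le> F2 y" "F2 y \<le> F2 (1/2 + \<delta>)"
    using False assms d by (intro F_mono; simp)+
  ultimately have "F1 y - F2 y \<le> \<kappa> / 2" "F2 y - F1 y \<le> \<kappa> / 2"
    using d(3) by (simp_all add: field_simps)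
  thus ?thesis unfolding abs_le_iff by auto
qed

text \<open>Each comparison contains at most four values of \<open>F\<close>, counted with
  multiplicity and each off by at most 3\<kappa>; with s \<le> \<kappa> this makes
  13\<kappa>.\<close>

lemma takes_base:
  assumes near: "\<And>x. 0 \<le> x \<Longrightarrow> x \<le> 1 \<Longrightarrow> \<bar>F x - min (4 * x / 3) 1\<bar> \<le> 3 * \<kappa>"
    and xyt: "0 \<le> x" "x \<le> y" "y \<le> t" "t \<le> 1" "y \<le> 3 / 4"
  defines "T \<equiv> min (4 * t / 3) 1"
  shows "takes_left F s x y t \<Longrightarrow> 4 * y / 3 - 13 * \<kappa> \<le> 8 * x / 3 \<and> T - 13 * \<kappa> \<le> 4 * x / 3 + 4 * y / 3"
    and "takes_middle F s x y t \<Longrightarrow>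
      8 * x / 3 - 13 * \<kappa> \<le> 4 * y / 3 \<and> T + 4 * x / 3 - 13 * \<kappa> \<le> 8 * y / 3"
    and "takes_right F s x y t \<Longrightarrow>
      4 * x / 3 + 4 * y / 3 - 13 * \<kappa> \<le> T \<and> 8 * y / 3 - 4 * x / 3 - 13 * \<kappa> \<le> T"
proof -
  have x: "F x \<le> 4 * x / 3 + 3 * \<kappa>" "4 * x / 3 - 3 * \<kappa> \<le> F x"
    using near[of x] xyt by auto
  have y: "F y \<le> 4 * y / 3 + 3 * \<kappa>" "4 * y / 3 - 3 * \<kappa> \<le> F y"
    using near[of y] xyt by auto
  have t: "F t \<le> T + 3 * \<kappa>" "T - 3 * \<kappa> \<le> F t"
    using near[of t] xyt unfolding T_def by auto
  have s: "s \<le> \<kappa>" using const by linarith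
  show "takes_left F s x y t \<Longrightarrow> 4 * y / 3 - 13 * \<kappa> \<le> 8 * x / 3 \<and> T - 13 * \<kappa> \<le> 4 * x / 3 + 4 * y / 3"
    unfolding takes_left_def by (elim conjE, intro conjI; use x y t s in linarith)
  show "takes_middle F s x y t \<Longrightarrow>
      8 * x / 3 - 13 * \<kappa> \<le> 4 * y / 3 \<and> T + 4 * x / 3 - 13 * \<kappa> \<le> 8 * y / 3"
    unfolding takes_middle_def by (elim conjE, intro conjI; use x y t s in linarith)
  show "takes_right F s x y t \<Longrightarrow>
      4 * x / 3 + 4 * y / 3 - 13 * \<kappa> \<le> T \<and> 8 * y / 3 - 4 * x / 3 - 13 * \<kappa> \<le> T"
    unfolding takes_right_def by (elim conjE, intro conjI; use x y t s in linarith)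
qed

text \<open>If t < 3/4, the wishes of players 1 and 2 limit the share of player 3 to 1/3 +
  O(\<kappa>), against \<open>short\<close>. If t \<ge> 3/4, then \<open>long\<close> rules out the
  right piece for player 3, and the remaining orders put 4x/3 and 4y/3 within 30\<kappa> of 1/3 and
  2/3. Both arguments rest on \<omega> being large compared with \<kappa>.\<close>

lemma localise:
  assumes xyt: "0 \<le> x" "x \<le> y" "y \<le> t" "t \<le> 1" "y \<le> 3 / 4"
    and owners:
      "takes_left D s x y t \<and> takes_middle F1 s x y t \<and> takes_right F2 s x y t \<and> d = D x \<or>
       takes_left D s x y t \<and> takes_middle F2 s x y t \<and> takes_right F1 s x y t \<and> d = D x \<or>
       takes_left F1 s x y t \<and> takes_middle D s x y t \<and> takes_right F2 s x y t \<and> d = D y - D x \<or>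
       takes_left F2 s x y t \<and> takes_middle D s x y t \<and> takes_right F1 s x y t \<and> d = D y - D x \<or>
       takes_left F1 s x y t \<and> takes_middle F2 s x y t \<and> takes_right D s x y t \<and> d = D t - D y \<or>
       takes_left F2 s x y t \<and> takes_middle F1 s x y t \<and> takes_right D s x y t \<and> d = D t - D y"
    and short: "t < 3 / 4 \<Longrightarrow> 1 / 3 + \<omega> - s \<le> d"
    and long: "3 / 4 \<le> t \<Longrightarrow> D t - D (3 / 4) \<le> 1 / 3 - \<omega> + s"
  shows "3 / 4 \<le> t \<and> 1 / 8 \<le> x \<and> x \<le> 3 / 8 \<and> 7 / 16 \<le> y \<and> y \<le> 9 / 16 \<and>
    \<not> takes_right D s x y t"
proof -
  define T where "T = min (4 * t / 3) 1"
  note b1 = takes_base[of F1, OF near1 xyt, folded T_def]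
  note b2 = takes_base[of F2, OF near2 xyt, folded T_def]
  have T: "T \<le> 1" by (simp add: T_def)
  have c: "0 < \<kappa>" "s \<le> \<kappa>" "0 < s" "0 < \<delta>" "\<delta> \<le> \<kappa>" "200 * \<kappa> \<le> \<omega>" "\<kappa> \<le> 1 / 3600"
    using const by linarith+
  have Dx: "x \<le> 1 / 2 + \<delta> \<and> D x = 4 * x / 3 \<or> 1 / 2 + \<delta> \<le> x \<and> D x = 2 / 3 + 4 * \<delta> / 3"
    and Dy: "y \<le> 1 / 2 + \<delta> \<and> D y = 4 * y / 3 \<or> 1 / 2 + \<delta> \<le> y \<and> D y = 2 / 3 + 4 * \<delta> / 3"
    using D[of x] D[of y] xyt by (auto simp: min_def)
  have Dle: "D x \<le> 4 * x / 3" "D y \<le> 4 * y / 3" "D y - D x \<le> 4 * y / 3 - 4 * x / 3"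
    "D x \<le> 2 / 3 + 4 * \<delta> / 3" "D y \<le> 2 / 3 + 4 * \<delta> / 3"
    using Dx Dy xyt by auto
  have D34: "D (3 / 4) = 2 / 3 + 4 * \<delta> / 3"
    using D[of "3/4"] c by (auto simp: min_def)
  have T1: "T = 1" "D t \<le> 1 - \<omega> + s + 4 * \<delta> / 3" if "3 / 4 \<le> t"
    using long[OF that] D34 that by (auto simp: T_def)
  \<comment> \<open>Before 3/4 the slope of \<open>D\<close> is at most 4/3, so player 3 values the
    right piece at most at 4/3 of its length.\<close>
  have T_short: "D t - D y \<le> T - 4 * y / 3" if "t < 3 / 4"
    using D[of t] that Dy xyt by (cases "t \<le> 1 / 2 + \<delta>") (auto simp: T_def min_def)
  have fin: ?thesis if t: "3 / 4 \<le> t"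
    and X: "1 / 3 - 30 * \<kappa> \<le> 4 * x / 3" "4 * x / 3 \<le> 1 / 3 + 30 * \<kappa>"
    and Y: "2 / 3 - 30 * \<kappa> \<le> 4 * y / 3" "4 * y / 3 \<le> 2 / 3 + 30 * \<kappa>"
  proof -
    have "1 / 3 - 30 * \<kappa> \<le> D x" by (rule disjE[OF Dx]; use X c in linarith)
    moreover have "2 / 3 - 30 * \<kappa> \<le> D y" by (rule disjE[OF Dy]; use Y c in linarith)
    ultimately have "\<not> takes_right D s x y t"
      using T1(2)[OF t] c unfolding takes_right_def by linarith
    with t X Y c show ?thesis by (intro conjI; linarith)
  qed
  have L: ?thesis if "takes_left D s x y t" "d = D x"
    and b: "8 * x / 3 - 13 * \<kappa> \<le> 4 * y / 3" "T + 4 * x / 3 - 13 * \<kappa> \<le> 8 * y / 3"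
    "4 * x / 3 + 4 * y / 3 - 13 * \<kappa> \<le> T" "8 * y / 3 - 4 * x / 3 - 13 * \<kappa> \<le> T"
  proof (cases "t < 3 / 4")
    case True
    hence False using short[OF True] that(2) Dle(1) b(1,3) T c by linarith
    thus ?thesis ..
  next
    case False
    hence t: "3 / 4 \<le> t" by simp
    have "D y \<le> 2 * D x + s" using that(1) unfolding takes_left_def by linarith
    moreover have X: "4 * x / 3 \<le> 1 / 3 + 10 * \<kappa>" using b(1,3) T c by linarith
    ultimately have e: "D y \<le> 8 * x / 3 + s" using Dle(1) by linarith
    have Y: "4 * y / 3 \<le> 2 / 3 + 22 * \<kappa>"
      by (rule disjE[OF Dy]; use X e c b(3) T in linarith)
    have X': "1 / 3 - 20 * \<kappa> \<le> 4 * x / 3"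
      by (rule disjE[OF Dy]; use e c b(2) T1(1)[OF t] in linarith)
    moreover have "2 / 3 - 30 * \<kappa> \<le> 4 * y / 3" using X' b(2) T1(1)[OF t] c by linarith
    ultimately show ?thesis using fin[OF t] X Y c by linarith
  qed
  have M: ?thesis if "takes_middle D s x y t" "d = D y - D x"
    and b: "4 * y / 3 - 13 * \<kappa> \<le> 8 * x / 3" "T - 13 * \<kappa> \<le> 4 * x / 3 + 4 * y / 3"
    "4 * x / 3 + 4 * y / 3 - 13 * \<kappa> \<le> T" "8 * y / 3 - 4 * x / 3 - 13 * \<kappa> \<le> T"
  proof (cases "t < 3 / 4")
    case True
    hence False using short[OF True] that(2) Dle(3) b(1,4) T c by linarith
    thus ?thesis ..
  next
    case False
    hence t: "3 / 4 \<le> t" by simp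
    have e: "2 * D x \<le> D y + s" using that(1) unfolding takes_middle_def by linarith
    have X: "4 * x / 3 \<le> 1 / 3 + 10 * \<kappa>"
      by (rule disjE[OF Dx]; use e c b(4) T Dle(2,5) in linarith)
    moreover have Y: "2 / 3 - 25 * \<kappa> \<le> 4 * y / 3" using X b(2) T1(1)[OF t] c by linarith
    moreover have "1 / 3 - 30 * \<kappa> \<le> 4 * x / 3" using Y b(1) c by linarith
    moreover have "4 * y / 3 \<le> 2 / 3 + 30 * \<kappa>" using X b(4) T c by linarith
    ultimately show ?thesis using fin[OF t] c by linarith
  qed
  have R: ?thesis if "takes_right D s x y t" "d = D t - D y"
    and b: "4 * y / 3 - 13 * \<kappa> \<le> 8 * x / 3" "T - 13 * \<kappa> \<le> 4 * x / 3 + 4 * y / 3"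
    "8 * x / 3 - 13 * \<kappa> \<le> 4 * y / 3" "T + 4 * x / 3 - 13 * \<kappa> \<le> 8 * y / 3"
  proof (cases "t < 3 / 4")
    case True
    hence False using short[OF True] that(2) T_short[OF True] b(2,4) T c by linarith
    thus ?thesis ..
  next
    case False
    hence t: "3 / 4 \<le> t" by simp
    have e: "D x - s \<le> D t - D y" using that(1) unfolding takes_right_def by linarith
    have Y: "2 / 3 - 9 * \<kappa> \<le> 4 * y / 3" using b(2,4) T1(1)[OF t] c by linarith
    have X: "1 / 3 - 12 * \<kappa> \<le> 4 * x / 3" using Y b(1) c by linarith
    have "1 / 3 - 12 * \<kappa> \<le> D x" by (rule disjE[OF Dx]; use X c in linarith)
    moreover have "2 / 3 - 9 * \<kappa> \<le> D y" by (rule disjE[OF Dy]; use Y c in linarith)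
    ultimately have False using e T1(2)[OF t] c by linarith
    thus ?thesis ..
  qed
  show ?thesis
    using owners
  proof (elim disjE conjE)
    assume "takes_left D s x y t" "takes_middle F1 s x y t" "takes_right F2 s x y t" "d = D x"
    with L b1(2) b2(3) show ?thesis by blast
  next
    assume "takes_left D s x y t" "takes_middle F2 s x y t" "takes_right F1 s x y t" "d = D x"
    with L b2(2) b1(3) show ?thesis by blast
  next
    assume "takes_left F1 s x y t" "takes_middle D s x y t" "takes_right F2 s x y t" "d = D y - D x"
    with M b1(1) b2(3) show ?thesis by blast
  next
    assume "takes_left F2 s x y t" "takes_middle D s x y t" "takes_right F1 s x y t" "d = D y - D x"
    with M b2(1) b1(3) show ?thesis by blast
  next
    assume "takes_left F1 s x y t" "takes_middle F2 s x y t" "takes_right D s x y t" "d = D t - D y"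
    with R b1(1) b2(2) show ?thesis by blast
  next
    assume "takes_left F2 s x y t" "takes_middle F1 s x y t" "takes_right D s x y t" "d = D t - D y"
    with R b2(1) b1(2) show ?thesis by blast
  qed
qed

text \<open>On y = 2x, the indifference of player 1 between middle and right reads F1 y = 1/2 + y/3
  - \<kappa>, and that of player 2 between left and right reads F2 y = 1 - 2y/3 - \<kappa>. At y =
  1/2 + \<tau> both hold by \<open>mid1\<close> and \<open>mid2\<close>. The functions rise at rate
  at least 9/10 and 3/5, faster than these lines, so on either side of 1/2 + \<tau> one of the two
  wishes keeps y within O(s).\<close>

lemma rigid:
  assumes xyt: "1 / 8 \<le> x" "x \<le> 3 / 8" "7 / 16 \<le> y" "y \<le> 9 / 16" "3 / 4 \<le> t" "t \<le> 1"
    and owners: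
      "takes_left D s x y t \<and> takes_middle F1 s x y t \<and> takes_right F2 s x y t \<or>
       takes_left D s x y t \<and> takes_middle F2 s x y t \<and> takes_right F1 s x y t \<or>
       takes_left F1 s x y t \<and> takes_middle D s x y t \<and> takes_right F2 s x y t \<or>
       takes_left F2 s x y t \<and> takes_middle D s x y t \<and> takes_right F1 s x y t"
  shows "\<bar>y - 1 / 2 - \<tau>\<bar> \<le> 10 * s"
proof -
  have x: "F1 x = 4 * x / 3 - 2 * \<kappa>" "F2 x = 4 * x / 3 + \<kappa>" using low1 low2 xyt by auto
  have d: "\<delta> \<le> 1 / 16" using const by linarith
  have s: "0 < s" "3 * s < 2 * \<kappa>" using const by linarith+
  have Dx: "D x = 4 * x / 3"
    using D[of x] xyt const by (auto simp: min_def)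
  have Dy: "y \<le> 1 / 2 + \<delta> \<and> D y = 4 * y / 3 \<or> 1 / 2 + \<delta> \<le> y \<and> D y = 2 / 3 + 4 * \<delta> / 3"
    using D[of y] xyt const by (auto simp: min_def)
  have t: "1 - s \<le> F1 t" "F1 t \<le> 1" "1 - s \<le> F2 t" "F2 t \<le> 1"
    using top1[of t] top2[of t] xyt by auto
  have c: "F1 y - F2 y \<le> \<kappa> / 2" "F2 y - F1 y \<le> \<kappa> / 2"
    using F1_close_F2[of y] xyt unfolding abs_le_iff by linarith+
  have tt: "\<tau> \<le> \<delta>" "-\<delta> \<le> \<tau>" using tau by auto
  show ?thesis
    using owners
  proof (elim disjE conjE)
    assume D3: "takes_left D s x y t" and D1: "takes_middle F1 s x y t" and D2: "takes_right F2 s x y t"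
    have h3: "D y \<le> 8 * x / 3 + s" using D3 Dx unfolding takes_left_def by auto
    have h2: "F2 y \<le> 1 - \<kappa> - 4 * x / 3 + s" using D2 t(4) x unfolding takes_right_def by auto
    have h1: "2 * F1 y \<ge> 1 - 2 * \<kappa> + 4 * x / 3 - 2 * s" using D1 t(1) x unfolding takes_middle_def by auto
    show ?thesis
    proof (cases "1 / 2 + \<tau> \<le> y")
      case True
      have sl: "3 / 5 * (y - (1 / 2 + \<tau>)) \<le> F2 y - (2 / 3 - \<kappa> - 2 * \<tau> / 3)"
        using steep2[of "1/2 + \<tau>" y] mid2 True tt xyt d by auto
      \<comment> \<open>Past 1/2 + \<delta> the function \<open>D\<close> is constant, but because
        \<tau> \<le> \<delta> its value there still forces \<open>x\<close> to be large
        enough.\<close>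
      have "F2 y \<le> 2 / 3 - \<kappa> - 2 * \<tau> / 3 + 2 * s"
        by (rule disjE[OF Dy]; use h3 h2 s(1) tt(1) True in simp)
      hence "y - 1 / 2 - \<tau> \<le> 10 * s" using sl s(1) by (simp add: field_simps)
      with True show ?thesis by simp
    next
      case False
      have sl: "9 / 10 * ((1 / 2 + \<tau>) - y) \<le> (2 / 3 - \<kappa> + \<tau> / 3) - F1 y"
        using steep1[of y "1/2 + \<tau>"] mid1 False tt xyt d by auto
      have "1 / 2 + y / 3 - \<kappa> - 2 * s \<le> F1 y"
        by (rule disjE[OF Dy]; use h3 h1 s(1) tt(1) False in simp)
      hence "1 / 2 + \<tau> - y \<le> 10 * s" using sl s(1) by (simp add: field_simps)
      with False show ?thesis by simp
    qed
  next
    \<comment> \<open>Player 2 would get the disliked middle piece: 2 * (F2 y - F1 y) would be at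
      least 3\<kappa> - 3s, but it is at most \<kappa>.\<close>
    assume D3: "takes_left D s x y t" and D2: "takes_middle F2 s x y t" and D1: "takes_right F1 s x y t"
    have h1: "2 * F1 y \<le> 1 + 4 * x / 3 - 2 * \<kappa> + s" using D1 t(2) x unfolding takes_right_def by auto
    have h2: "2 * F2 y \<ge> 1 + 4 * x / 3 + \<kappa> - 2 * s" using D2 t(3) x unfolding takes_middle_def by auto
    from h1 h2 c(2) s(2) have False by linarith
    thus ?thesis ..
  next
    \<comment> \<open>Player 1 would get the disliked left piece: F1 y - F2 y would be at least
      3\<kappa> - 3s, but it is at most \<kappa>/2.\<close>
    assume D1: "takes_left F1 s x y t" and D3: "takes_middle D s x y t" and D2: "takes_right F2 s x y t"
    have h1: "F1 y \<ge> 1 - 4 * x / 3 + 2 * \<kappa> - 2 * s" using D1 t(1) x unfolding takes_left_def by auto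
    have h2: "F2 y \<le> 1 - 4 * x / 3 - \<kappa> + s" using D2 t(4) x unfolding takes_right_def by auto
    from h1 h2 c(1) s have False by linarith
    thus ?thesis ..
  next
    assume D2: "takes_left F2 s x y t" and D3: "takes_middle D s x y t" and D1: "takes_right F1 s x y t"
    have h3: "D y \<ge> 8 * x / 3 - s" using D3 Dx unfolding takes_middle_def by auto
    have h1: "2 * F1 y \<le> 1 + 4 * x / 3 - 2 * \<kappa> + s" using D1 t(2) x unfolding takes_right_def by auto
    have h2: "F2 y \<ge> 1 - 4 * x / 3 - \<kappa> - 2 * s" using D2 t(3) x unfolding takes_left_def by auto
    show ?thesis
    proof (cases "1 / 2 + \<tau> \<le> y")
      case True
      have sl: "9 / 10 * (y - (1 / 2 + \<tau>)) \<le> F1 y - (2 / 3 - \<kappa> + \<tau> / 3)"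
        using steep1[of "1/2 + \<tau>" y] mid1 True tt xyt d by auto
      have "F1 y \<le> 1 / 2 + y / 3 - \<kappa> + s"
        by (rule disjE[OF Dy]; use h3 h1 s(1) in simp)
      hence "y - 1 / 2 - \<tau> \<le> 10 * s" using sl s(1) by (simp add: field_simps)
      with True show ?thesis by simp
    next
      case False
      have sl: "3 / 5 * ((1 / 2 + \<tau>) - y) \<le> (2 / 3 - \<kappa> - 2 * \<tau> / 3) - F2 y"
        using steep2[of y "1/2 + \<tau>"] mid2 False tt xyt d by auto
      have "1 - 2 * y / 3 - \<kappa> - 3 * s \<le> F2 y"
        by (rule disjE[OF Dy]; use h3 h2 s(1) in simp)
      hence "1 / 2 + \<tau> - y \<le> 10 * s" using sl s(1) by (simp add: field_simps)
      with False show ?thesis by simp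
    qed
  qed
qed

end

section \<open>Order of the pieces\<close>

lemma has_cdf_has_integral_between:
  assumes F: "has_cdf f F" and ab: "0 \<le> a" "a \<le> b" "b \<le> 1" and S: "{a<..<b} \<subseteq> S" "S \<subseteq> {a..b}"
  shows "(f has_integral (F b - F a)) S" and "val f S = F b - F a"
proof -
  have "S = {a<..<b} \<union> (S \<inter> {a, b})" using S by force
  also have "\<dots> \<in> sets lebesgue"
    by (intro sets.Un) (auto intro: negligible_imp_sets negligible_finite)
  finally have m: "S \<in> sets lebesgue" .
  have "negligible {x \<in> S - {a..b}. f x \<noteq> 0}" "negligible {x \<in> {a..b} - S. f x \<noteq> 0}"
    by (rule negligible_subset[of "{a, b}"]; use S in force)+
  from has_integral_spike_set_eq[OF this] has_cdf_has_integral[OF F ab(1,2)]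
  show *: "(f has_integral (F b - F a)) S" by simp
  have "f absolutely_integrable_on S"
    using S ab by (intro has_cdf_absolutely_integrable[OF F _ m]) force
  thus "val f S = F b - F a" unfolding val_def
    using set_lebesgue_integral_eq_integral(2) integral_unique[OF *] by metis
qed

lemma interval_endpoints:
  fixes S :: "real set"
  assumes "is_interval S" "S \<subseteq> {0..1}"
  obtains a b where "0 \<le> a" "a \<le> b" "b \<le> 1" "{a<..<b} \<subseteq> S" "S \<subseteq> {a..b}"
proof (cases "S = {}")
  case True
  thus ?thesis using that[of 0 0] by simp
next
  case False
  have bd: "bdd_below S" "bdd_above S"
    using assms(2) by (auto intro!: bdd_belowI[of _ 0] bdd_aboveI[of _ 1])
  obtain x where x: "x \<in> S" using False by blast
  have sub: "S \<subseteq> {Inf S..Sup S}" using bd by (auto intro: cInf_lower cSup_upper)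
  have in01: "0 \<le> Inf S" "Sup S \<le> 1"
    using assms(2) False by (auto intro!: cInf_greatest cSup_least)
  have "{Inf S<..<Sup S} \<subseteq> S"
  proof
    fix y assume "y \<in> {Inf S<..<Sup S}"
    hence y: "Inf S < y" "y < Sup S" by auto
    obtain u v where "u \<in> S" "u < y" "v \<in> S" "y < v"
      using y cInf_lessD[OF False y(1)] less_cSupD[OF False y(2)] by blast
    thus "y \<in> S" using assms(1) unfolding is_interval_1 by (meson less_imp_le)
  qed
  thus ?thesis using that[of "Inf S" "Sup S"] sub in01 x by force
qed

lemma connected_allocation_endpoints:
  assumes "connected_allocation n A"
  obtains a b where "\<And>i. i \<in> {1..n} \<Longrightarrow> 0 \<le> a i \<and> a i \<le> b i \<and> b i \<le> 1 \<and> {a i<..<b i} \<subseteq> A i \<and> A i \<subseteq> {a i..b i}"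
proof -
  have "\<forall>i\<in>{1..n}. \<exists>p. 0 \<le> fst p \<and> fst p \<le> snd p \<and> snd p \<le> 1 \<and> {fst p<..<snd p} \<subseteq> A i \<and> A i \<subseteq> {fst p..snd p}"
  proof
    fix i assume i: "i \<in> {1..n}"
    hence "is_interval (A i)" "A i \<subseteq> {0..1}"
      using assms unfolding connected_allocation_def allocation_def by blast+
    from interval_endpoints[OF this] obtain a b
      where "0 \<le> a" "a \<le> b" "b \<le> 1" "{a<..<b} \<subseteq> A i" "A i \<subseteq> {a..b}" .
    thus "\<exists>p. 0 \<le> fst p \<and> fst p \<le> snd p \<and> snd p \<le> 1 \<and> {fst p<..<snd p} \<subseteq> A i \<and> A i \<subseteq> {fst p..snd p}"
      by (intro exI[of _ "(a, b)"]) auto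
  qed
  from bchoice[OF this] obtain p where "\<forall>i\<in>{1..n}. 0 \<le> fst (p i) \<and> fst (p i) \<le> snd (p i) \<and>
      snd (p i) \<le> 1 \<and> {fst (p i)<..<snd (p i)} \<subseteq> A i \<and> A i \<subseteq> {fst (p i)..snd (p i)}" by blast
  thus ?thesis using that[of "\<lambda>i. fst (p i)" "\<lambda>i. snd (p i)"] by auto
qed

text \<open>An empty or one-point piece may sit anywhere, even inside another piece; hence
  \<open>ordered\<close> speaks only of nondegenerate intervals.\<close>

locale interval_division =
  fixes n :: nat and a b :: "nat \<Rightarrow> real"
  assumes bounds: "i \<in> {1..n} \<Longrightarrow> 0 \<le> a i \<and> a i \<le> b i \<and> b i \<le> 1"
    and ordered: "i \<in> {1..n} \<Longrightarrow> j \<in> {1..n} \<Longrightarrow> i \<noteq> j \<Longrightarrow> a i < b i \<Longrightarrow> a j < b j \<Longrightarrow>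
      b i \<le> a j \<or> b j \<le> a i"
    and cover: "0 \<le> p \<Longrightarrow> p \<le> 1 \<Longrightarrow> \<exists>i\<in>{1..n}. a i \<le> p \<and> p \<le> b i"

lemma allocation_interval_division:
  assumes A: "allocation n A"
    and ab: "\<And>i. i \<in> {1..n} \<Longrightarrow>
      0 \<le> a i \<and> a i \<le> b i \<and> b i \<le> 1 \<and> {a i<..<b i} \<subseteq> A i \<and> A i \<subseteq> {a i..b i}"
  shows "interval_division n a b"
proof
  fix i j assume ij: "i \<in> {1..n}" "j \<in> {1..n}" "i \<noteq> j" "a i < b i" "a j < b j"
  show "b i \<le> a j \<or> b j \<le> a i"
  proof (rule ccontr)
    assume "\<not> ?thesis"
    hence "{max (a i) (a j)<..<min (b i) (b j)} \<noteq> {}"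
      using ij unfolding greaterThanLessThan_empty_iff by auto
    moreover have "negligible {max (a i) (a j)<..<min (b i) (b j)}"
      by (rule negligible_subset[of "A i \<inter> A j"])
         (use A ij ab[OF ij(1)] ab[OF ij(2)] in \<open>auto simp: allocation_def subset_eq\<close>)
    ultimately show False
      using open_not_negligible open_greaterThanLessThan by blast
  qed
next
  fix p :: real assume "0 \<le> p" "p \<le> 1"
  hence "p \<in> (\<Union>i\<in>{1..n}. A i)" using A by (simp add: allocation_def)
  then obtain i where "i \<in> {1..n}" "p \<in> A i" by blast
  thus "\<exists>i\<in>{1..n}. a i \<le> p \<and> p \<le> b i" using ab[of i] by (intro bexI[of _ i]) auto
qed (use ab in auto)

lemma allocation_sum:
  assumes A: "allocation n A"
    and ab: "\<And>i. i \<in> {1..n} \<Longrightarrow>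
      0 \<le> a i \<and> a i \<le> b i \<and> b i \<le> 1 \<and> {a i<..<b i} \<subseteq> A i \<and> A i \<subseteq> {a i..b i}"
    and F: "has_cdf f F"
  shows "(\<Sum>i=1..n. F (b i) - F (a i)) = 1"
proof -
  have "(f has_integral (\<Sum>i=1..n. F (b i) - F (a i))) (\<Union>i\<in>{1..n}. A i)"
  proof (rule has_integral_UN)
    fix i assume "i \<in> {1..n}"
    thus "(f has_integral (F (b i) - F (a i))) (A i)"
      using ab[of i] by (intro has_cdf_has_integral_between[OF F]) auto
  qed (use A in \<open>auto simp: allocation_def pairwise_def\<close>)
  moreover have "(\<Union>i\<in>{1..n}. A i) = {0..1}" using A by (simp add: allocation_def)
  ultimately have "(f has_integral (\<Sum>i=1..n. F (b i) - F (a i))) {0..1}" by simp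
  moreover have "(f has_integral 1) {0..1}"
    using has_cdf_integral[OF F, of 1] has_cdf_1[OF F] by simp
  ultimately show ?thesis by (rule has_integral_unique)
qed

text \<open>Here \<open>F1\<close>, \<open>F2\<close>, \<open>N\<close> are the distribution functions of players 1 and 2 and of the players from
  4 on, \<open>D\<close> is that of player 3, rescaled to total mass \<open>\<sigma> + q\<close>, of which \<open>q\<close> lies in \<open>[3/4, 1]\<close>,
  and \<open>a i\<close>, \<open>b i\<close> are the ends of the piece of player \<open>i\<close>. The bounds on \<open>q\<close> say that its division among
  the players from 4 on alone gives shares above \<open>1/3\<close>, but one more participant brings them below.\<close>

locale left_three = interval_division +
  fixes F1 F2 D N :: "real \<Rightarrow> real" and \<epsilon> s \<omega> \<sigma> q :: real
  assumes n3: "3 \<le> n"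
    and mono: "x \<le> y \<Longrightarrow> F1 x \<le> F1 y" "x \<le> y \<Longrightarrow> F2 x \<le> F2 y" "x \<le> y \<Longrightarrow> D x \<le> D y" "x \<le> y \<Longrightarrow> N x \<le> N y"
    and sum1: "(\<Sum>i=1..n. F1 (b i) - F1 (a i)) = 1"
    and sum2: "(\<Sum>i=1..n. F2 (b i) - F2 (a i)) = 1"
    and sumD: "(\<Sum>i=1..n. D (b i) - D (a i)) = \<sigma> + q"
    and sumN: "(\<Sum>i=1..n. N (b i) - N (a i)) = 1"
    and ef1: "i \<in> {1..n} \<Longrightarrow> F1 (b i) - F1 (a i) - \<epsilon> \<le> F1 (b 1) - F1 (a 1)"
    and ef2: "i \<in> {1..n} \<Longrightarrow> F2 (b i) - F2 (a i) - \<epsilon> \<le> F2 (b 2) - F2 (a 2)"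
    and efD: "i \<in> {1..n} \<Longrightarrow> D (b i) - D (a i) - s \<le> D (b 3) - D (a 3)"
    and efN: "i \<in> {1..n} \<Longrightarrow> k \<in> {4..n} \<Longrightarrow> N (b i) - N (a i) - \<epsilon> \<le> N (b k) - N (a k)"
    and tail: "1 - \<epsilon> \<le> F1 (3/4)" "1 - \<epsilon> \<le> F2 (3/4)" "\<And>x. x \<le> 1 \<Longrightarrow> F1 x \<le> 1" "\<And>x. x \<le> 1 \<Longrightarrow> F2 x \<le> 1"
    and N0: "x \<le> 3 / 4 \<Longrightarrow> N x = 0"
    and DN: "3 / 4 \<le> x \<Longrightarrow> x \<le> 1 \<Longrightarrow> D x = \<sigma> + q * N x"
    and \<sigma>: "2 / 3 \<le> \<sigma>"
    and q: "0 < q" "(real n - 3) * (1 / 3 + \<omega>) \<le> q" "q \<le> (real n - 2) * (1 / 3 - \<omega>)" "q \<le> n"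
    and small: "0 < \<epsilon>" "s = real n * \<epsilon>" "real n * s < \<omega>" "\<omega> \<le> 1 / 18" "(real n + \<sigma> + q) * s < 1 / 2"
begin

lemma split3: "(\<Sum>i=1..n. f i) = f 1 + f 2 + f 3 + (\<Sum>i=4..n. f i)" for f :: "nat \<Rightarrow> real"
proof -
  have "{1..n} = {1, 2, 3} \<union> {4..n}" using n3 by auto
  also have "sum f \<dots> = sum f {1, 2, 3} + sum f {4..n}"
    by (rule sum.union_disjoint) auto
  finally show ?thesis by simp
qed

text \<open>Summing the no-envy conditions over all pieces shows that a nearly envy-free share is
  nearly proportional.\<close>

lemma share_lower:
  fixes f :: "nat \<Rightarrow> real"
  assumes "(\<Sum>i=1..n. f i) = c" "\<And>i. i \<in> {1..n} \<Longrightarrow> f i - e \<le> r"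
  shows "c \<le> real n * (r + e)"
proof -
  have "(\<Sum>i=1..n. f i) \<le> (\<Sum>i=1..n. r + e)"
    by (rule sum_mono) (use assms(2) in force)
  thus ?thesis using assms(1) by simp
qed

text \<open>Besides the n - 3 players from 4 on there is one more participant, with share \<nu>,
  whom none of them envies by more than \<epsilon>. Hence (n - 2) * \<nu> \<le> 1 + (n - 3) *
  \<epsilon>, and the upper bound on \<open>q\<close> turns this into a bound in the units of player
  3.\<close>

lemma share_N:
  assumes "0 \<le> \<nu>" "\<And>k. k \<in> {4..n} \<Longrightarrow> \<nu> - \<epsilon> \<le> N (b k) - N (a k)"
    and "\<nu> + (\<Sum>k=4..n. N (b k) - N (a k)) \<le> 1"
  shows "q * \<nu> \<le> 1 / 3 - \<omega> + s"
proof -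
  have "(\<Sum>k=4..n. \<nu> - \<epsilon>) \<le> (\<Sum>k=4..n. N (b k) - N (a k))"
    by (rule sum_mono) (use assms(2) in auto)
  hence "(real n - 3) * (\<nu> - \<epsilon>) + \<nu> \<le> 1"
    using assms(3) n3 by (simp add: of_nat_diff)
  hence 1: "(real n - 2) * \<nu> \<le> 1 + (real n - 3) * \<epsilon>" by (simp add: algebra_simps)
  have "q * \<nu> \<le> (real n - 2) * (1 / 3 - \<omega>) * \<nu>"
    using q(3) assms(1) by (rule mult_right_mono)
  also have "\<dots> = (1 / 3 - \<omega>) * ((real n - 2) * \<nu>)" by simp
  also have "\<dots> \<le> (1 / 3 - \<omega>) * (1 + (real n - 3) * \<epsilon>)"
    using 1 small by (intro mult_left_mono) auto
  also have "\<dots> = (1 / 3 - \<omega>) + (1 / 3 - \<omega>) * ((real n - 3) * \<epsilon>)" by (simp add: algebra_simps)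
  also have "(1 / 3 - \<omega>) * ((real n - 3) * \<epsilon>) \<le> 1 * (real n * \<epsilon>)"
  proof (rule mult_mono)
    have "0 < s" using small n3 by simp
    hence "0 \<le> real n * s" by simp
    thus "1 / 3 - \<omega> \<le> 1" using small by linarith
  qed (use small n3 in auto)
  finally show ?thesis using small by simp
qed

lemma s_pos: "0 < s" using small n3 by simp

lemma eps_le: "\<epsilon> \<le> s"
proof -
  have "1 * \<epsilon> \<le> real n * \<epsilon>" using n3 small by (intro mult_right_mono) auto
  thus ?thesis using small by simp
qed

text \<open>By proportionality every share is positive, and for the players other than 3 it even
  exceeds \<epsilon>. As \<open>N\<close> vanishes before 3/4 and \<open>F1\<close>,
  \<open>F2\<close> gain at most \<epsilon> after it, this locates the pieces roughly.\<close>

lemma nonempty: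
  assumes "i \<in> {1..n}"
  shows "a i < b i" and "i \<ge> 4 \<Longrightarrow> 3 / 4 < b i" and "i \<le> 2 \<Longrightarrow> a i < 3 / 4"
proof -
  have small': "2 * real n * \<epsilon> < 1" "real n * s < 1 / 2"
  proof -
    have "0 \<le> (\<sigma> + q) * s" using \<sigma> q s_pos by simp
    thus *: "real n * s < 1 / 2" using small by (simp add: algebra_simps)
    have "1 * s \<le> real n * s" using n3 s_pos by (intro mult_right_mono) auto
    with * show "2 * real n * \<epsilon> < 1" using small by simp
  qed
  have L: "\<epsilon> < r" if "1 \<le> real n * (r + \<epsilon>)" for r
  proof (rule ccontr)
    assume "\<not> \<epsilon> < r"
    hence "real n * (r + \<epsilon>) \<le> real n * (\<epsilon> + \<epsilon>)" by (intro mult_left_mono) auto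
    thus False using that small' by simp
  qed
  have v1: "\<epsilon> < F1 (b 1) - F1 (a 1)" by (rule L[OF share_lower[OF sum1 ef1]])
  have v2: "\<epsilon> < F2 (b 2) - F2 (a 2)" by (rule L[OF share_lower[OF sum2 ef2]])
  have "\<sigma> + q \<le> real n * (D (b 3) - D (a 3) + s)" by (rule share_lower[OF sumD efD])
  moreover have "real n * s < 2 / 3" using small'(2) by simp
  moreover have "real n * (D (b 3) - D (a 3) + s) = real n * (D (b 3) - D (a 3)) + real n * s"
    by (simp add: distrib_left)
  ultimately have "0 < real n * (D (b 3) - D (a 3))" using \<sigma> q(1) by linarith
  hence v3: "0 < D (b 3) - D (a 3)" by (simp add: zero_less_mult_iff)
  have v4: "\<epsilon> < N (b k) - N (a k)" if "k \<in> {4..n}" for k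
    by (rule L[OF share_lower[OF sumN efN]]) (use that in auto)
  have ne: "a i < b i" if "F (b i) - F (a i) > 0" "\<And>x y. x \<le> y \<Longrightarrow> F x \<le> F y" for F :: "real \<Rightarrow> real"
    using that by (metis diff_gt_0_iff_gt linorder_not_less)
  have "i = 1 \<or> i = 2 \<or> i = 3 \<or> i \<in> {4..n}" using assms by auto
  thus "a i < b i"
    using ne[of F1] ne[of F2] ne[of D] ne[of N] v1 v2 v3 v4[of i] mono small by fastforce
  show "3 / 4 < b i" if "i \<ge> 4"
  proof (rule ccontr)
    assume "\<not> 3 / 4 < b i"
    hence "N (b i) = 0" "N (a i) = 0" using N0 bounds[OF assms] by auto
    thus False using v4[of i] that assms small by auto
  qed
  show "a i < 3 / 4" if "i \<le> 2"
  proof (rule ccontr)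
    assume "\<not> a i < 3 / 4"
    hence "3 / 4 \<le> a i" by simp
    hence "F1 (b i) - F1 (a i) \<le> \<epsilon>" "F2 (b i) - F2 (a i) \<le> \<epsilon>"
      using mono(1,2)[of "3/4" "a i"] tail bounds[OF assms] by fastforce+
    moreover have "i = 1 \<or> i = 2" using that assms by auto
    ultimately show False using v1 v2 by auto
  qed
qed

lemma share_nonneg:
  assumes "i \<in> {1..n}"
  shows "0 \<le> N (b i) - N (a i)"
  using mono(4)[of "a i" "b i"] bounds[OF assms] by auto

text \<open>Up to 3/4 the function \<open>N\<close> is constant while \<open>D\<close> can only
  gain; from there on D = \<sigma> + q * N.\<close>

lemma D_ge_N:
  assumes "x \<le> y" "0 \<le> x" "y \<le> 1"
  shows "q * (N y - N x) \<le> D y - D x"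
proof -
  have h: "q * (N y - N x) = D (max y (3/4)) - D (max x (3/4))"
    using DN[of "max y (3/4)"] DN[of "max x (3/4)"] N0[of x] N0[of y] N0[of "3/4"] assms
    by (auto simp: max_def algebra_simps)
  have D34: "D (3 / 4) = \<sigma>" using DN[of "3/4"] N0[of "3/4"] by simp
  show ?thesis
  proof (cases "x \<le> 3 / 4")
    case True
    show ?thesis
    proof (cases "y \<le> 3 / 4")
      case T: True
      thus ?thesis using N0 True mono(3)[OF assms(1)] by simp
    next
      case False
      thus ?thesis using h True mono(3)[OF True] by (simp add: max_def)
    qed
  next
    case False
    thus ?thesis using h assms by (simp add: max_def)
  qed
qed

text \<open>Suppose that piece 3 lies in the tail. By \<open>share_N\<close> it is worth at most 1/3
  - \<omega> + s to its owner, who thus values pieces 1 and 2 at hardly more, and the pieces from 4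
  on at hardly more than q times their \<nu>. Adding up leaves less than 2/3 for \<sigma>.\<close>

lemma third_meets_main: "a 3 < 3 / 4"
proof (rule ccontr)
  assume "\<not> a 3 < 3 / 4"
  hence a3: "3 / 4 \<le> a 3" by simp
  have b3: "a 3 \<le> b 3" "b 3 \<le> 1" using bounds[of 3] n3 by auto
  define \<nu> where "\<nu> k = N (b k) - N (a k)" for k
  define \<mu> where "\<mu> k = D (b k) - D (a k)" for k
  have \<mu>3: "\<mu> 3 = q * \<nu> 3"
    using DN[of "a 3"] DN[of "b 3"] a3 b3 by (simp add: \<mu>_def \<nu>_def algebra_simps)
  have nn: "0 \<le> \<nu> 1" "0 \<le> \<nu> 2" "0 \<le> \<nu> 3"
    using share_nonneg[of 1] share_nonneg[of 2] share_nonneg[of 3] n3 by (auto simp: \<nu>_def)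
  have s1: "\<nu> 1 + \<nu> 2 + \<nu> 3 + (\<Sum>k=4..n. \<nu> k) = 1"
    using sumN split3[of \<nu>] by (simp add: \<nu>_def)
  have s2: "\<mu> 1 + \<mu> 2 + \<mu> 3 + (\<Sum>k=4..n. \<mu> k) = \<sigma> + q"
    using sumD split3[of \<mu>] by (simp add: \<mu>_def)
  have e: "\<nu> 3 - \<epsilon> \<le> \<nu> k" if "k \<in> {4..n}" for k
    using efN[of 3 k] that n3 by (simp add: \<nu>_def)
  have c: "q * \<nu> 3 \<le> 1 / 3 - \<omega> + s"
    by (rule share_N) (use nn s1 e in \<open>auto simp: \<nu>_def\<close>)
  have m: "\<mu> k \<le> \<mu> 3 + s" if "k \<in> {1..n}" for k
    using efD[OF that] by (simp add: \<mu>_def)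
  \<comment> \<open>Two no-envy conditions combine here, that of player 3 towards piece k and that
    of player k towards piece 3. The error q * \<epsilon> is absorbed by s = n * \<epsilon>.\<close>
  have big: "\<mu> k \<le> q * \<nu> k + 2 * s" if "k \<in> {4..n}" for k
  proof -
    have "q * \<epsilon> \<le> real n * \<epsilon>" using q(4) small by (intro mult_right_mono) auto
    moreover have "q * (\<nu> 3 - \<epsilon>) \<le> q * \<nu> k" using e[OF that] q(1) by simp
    moreover have "\<mu> k \<le> q * \<nu> 3 + s" using m[of k] \<mu>3 that by auto
    ultimately show ?thesis using small(2) by (simp add: algebra_simps)
  qed
  have "(\<Sum>k=4..n. \<mu> k) \<le> (\<Sum>k=4..n. q * \<nu> k + 2 * s)" by (rule sum_mono) (rule big)
  also have "\<dots> = q * (\<Sum>k=4..n. \<nu> k) + (real n - 3) * (2 * s)"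
    using n3 by (simp add: sum.distrib sum_distrib_left of_nat_diff)
  also have "q * (\<Sum>k=4..n. \<nu> k) \<le> q * (1 - \<nu> 3)"
    using s1 nn q(1) by (intro mult_left_mono) auto
  finally have "\<sigma> + q \<le> (q * \<nu> 3 + s) + (q * \<nu> 3 + s) + q * \<nu> 3 + (q * (1 - \<nu> 3) + (real n - 3) * (2 * s))"
    using s2 m[of 1] m[of 2] \<mu>3 n3 by auto
  hence "\<sigma> \<le> 2 * (q * \<nu> 3) + 2 * s + (2 * (real n * s) - 6 * s)" by (simp add: algebra_simps)
  thus False using c \<sigma> small(3) s_pos by linarith
qed

lemma left_before_rest:
  assumes "i \<in> {1, 2, 3}" "k \<in> {4..n}"
  shows "b i \<le> a k"
proof -
  have i: "i \<in> {1..n}" and k: "k \<in> {1..n}" "i \<noteq> k" using assms n3 by auto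
  have "a i < 3 / 4" using assms(1) third_meets_main nonempty(3)[OF i] by auto
  moreover have "3 / 4 < b k" using nonempty(2)[OF k(1)] assms by auto
  ultimately show ?thesis
    using ordered[OF i k nonempty(1)[OF i] nonempty(1)[OF k(1)]] by auto
qed

definition pieces :: "nat \<Rightarrow> nat \<Rightarrow> nat \<Rightarrow> bool" where
  "pieces i j k \<longleftrightarrow> {i, j, k} = {1, 2, 3} \<and> a i = 0 \<and> b i = a j \<and> b j = a k"

text \<open>The midpoint of a gap left of piece j would belong to a piece from 4 on, but those lie
  to the right of piece j.\<close>

lemma no_gap:
  assumes "j \<in> {1, 2, 3}" "x < y" "y \<le> a j" "0 \<le> x"
    and "\<And>i. i \<in> {1, 2, 3} \<Longrightarrow> b i \<le> x \<or> y \<le> a i"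
  shows False
proof -
  define p where "p = (x + y) / 2"
  have p: "x < p" "p < y" using assms(2) by (auto simp: p_def)
  have j: "j \<in> {1..n}" using assms(1) n3 by auto
  have "p \<le> 1" using p assms(3) bounds[OF j] by auto
  then obtain k where k: "k \<in> {1..n}" "a k \<le> p" "p \<le> b k" using cover[of p] p assms(4) by auto
  have "k \<notin> {1, 2, 3}" using assms(5)[of k] k p by auto
  hence "k \<in> {4..n}" using k(1) by auto
  from left_before_rest[OF assms(1) this] have "b j \<le> a k" .
  thus False using nonempty(1)[OF j] k p assms(3) by auto
qed

lemma pieces_exist: "\<exists>i j k. pieces i j k"
proof -
  have in_n: "1 \<in> {1..n}" "2 \<in> {1..n}" "3 \<in> {1..n}" using n3 by auto
  note ne = nonempty(1)[OF in_n(1)] nonempty(1)[OF in_n(2)] nonempty(1)[OF in_n(3)]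
  have ord: "b 1 \<le> a 2 \<or> b 2 \<le> a 1" "b 1 \<le> a 3 \<or> b 3 \<le> a 1" "b 2 \<le> a 3 \<or> b 3 \<le> a 2"
    using ordered[OF in_n(1,2) _ ne(1,2)] ordered[OF in_n(1,3) _ ne(1,3)]
      ordered[OF in_n(2,3) _ ne(2,3)] by auto
  have sorted: "\<exists>i j k. {i, j, k} = {1, 2, 3::nat} \<and> b i \<le> a j \<and> b j \<le> a k"
  proof -
    have "b 1 \<le> a 2 \<and> b 2 \<le> a 3 \<or> b 1 \<le> a 3 \<and> b 3 \<le> a 2 \<or> b 2 \<le> a 1 \<and> b 1 \<le> a 3 \<or>
      b 2 \<le> a 3 \<and> b 3 \<le> a 1 \<or> b 3 \<le> a 1 \<and> b 1 \<le> a 2 \<or> b 3 \<le> a 2 \<and> b 2 \<le> a 1"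
      using ord ne by linarith
    moreover have "{1, 3, 2} = {1, 2, 3::nat}" "{2, 1, 3} = {1, 2, 3::nat}" "{2, 3, 1} = {1, 2, 3::nat}"
      "{3, 1, 2} = {1, 2, 3::nat}" "{3, 2, 1} = {1, 2, 3::nat}" by auto
    ultimately show ?thesis by metis
  qed
  then obtain i j k where p: "{i, j, k} = {1, 2, 3::nat}" and o: "b i \<le> a j" "b j \<le> a k" by blast
  have m: "i \<in> {1, 2, 3}" "j \<in> {1, 2, 3}" "k \<in> {1, 2, 3}" using p by blast+
  have mn: "i \<in> {1..n}" "j \<in> {1..n}" "k \<in> {1..n}" using m n3 by auto
  have all: "l = i \<or> l = j \<or> l = k" if "l \<in> {1, 2, 3}" for l using that p by blast
  note nm = nonempty(1)[OF mn(1)] nonempty(1)[OF mn(2)] nonempty(1)[OF mn(3)]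
  note bm = bounds[OF mn(1)] bounds[OF mn(2)] bounds[OF mn(3)]
  have "a i = 0"
  proof (rule ccontr)
    assume "a i \<noteq> 0"
    hence "0 < a i" using bm by auto
    from no_gap[OF m(1) this] all o nm show False by fastforce
  qed
  moreover have "b i = a j"
  proof (rule ccontr)
    assume "b i \<noteq> a j"
    hence "b i < a j" using o by auto
    from no_gap[OF m(2) this] all o nm bm show False by fastforce
  qed
  moreover have "b j = a k"
  proof (rule ccontr)
    assume "b j \<noteq> a k"
    hence "b j < a k" using o by auto
    from no_gap[OF m(3) this] all o nm bm show False by fastforce
  qed
  ultimately show ?thesis using p unfolding pieces_def by blast
qed

lemma pieces_bounds:
  assumes "pieces i j k"
  shows "0 \<le> b i" "b i \<le> b j" "b j \<le> b k" "b k \<le> 1" "b j \<le> 3 / 4"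
proof -
  have m: "i \<in> {1, 2, 3}" "j \<in> {1, 2, 3}" "k \<in> {1, 2, 3}" using assms unfolding pieces_def by blast+
  have mn: "i \<in> {1..n}" "j \<in> {1..n}" "k \<in> {1..n}" using m n3 by auto
  have "a k < 3 / 4" using m(3) third_meets_main nonempty(3)[OF mn(3)] by auto
  thus "0 \<le> b i" "b i \<le> b j" "b j \<le> b k" "b k \<le> 1" "b j \<le> 3 / 4"
    using bounds[OF mn(1)] bounds[OF mn(2)] bounds[OF mn(3)] assms unfolding pieces_def by auto
qed

text \<open>The tail is now shared by the players from 4 on alone. Player 3 envies none of them by
  more than s, and so gets, up to s, at least the average q / (n - 3) of what these pieces contain
  of the tail.\<close>

lemma pieces_short:
  assumes P: "pieces i j k" and t: "b k < 3 / 4"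
  shows "1 / 3 + \<omega> - s \<le> D (b 3) - D (a 3)"
proof -
  note B = pieces_bounds[OF P]
  have z: "N (b l) - N (a l) = 0" if "l \<in> {1, 2, 3}" for l
  proof -
    have "l \<in> {i, j, k}" using that P unfolding pieces_def by simp
    hence "b l < 3 / 4" using B t by auto
    moreover have "a l \<le> b l" using bounds[of l] that n3 by auto
    ultimately show ?thesis using N0 by simp
  qed
  have "(\<Sum>k=4..n. N (b k) - N (a k)) = 1"
    using sumN split3[of "\<lambda>k. N (b k) - N (a k)"] z by simp
  hence "q = (\<Sum>k=4..n. q * (N (b k) - N (a k)))" by (simp add: sum_distrib_left[symmetric])
  also have "\<dots> \<le> (\<Sum>k=4..n. D (b 3) - D (a 3) + s)"
  proof (rule sum_mono)
    fix k assume "k \<in> {4..n}"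
    hence k: "k \<in> {1..n}" by auto
    show "q * (N (b k) - N (a k)) \<le> D (b 3) - D (a 3) + s"
      using D_ge_N[of "a k" "b k"] bounds[OF k] efD[OF k] by auto
  qed
  also have "\<dots> = (real n - 3) * (D (b 3) - D (a 3) + s)" using n3 by (simp add: of_nat_diff)
  finally have 1: "q \<le> (real n - 3) * (D (b 3) - D (a 3) + s)" .
  hence "(real n - 3) * (1 / 3 + \<omega>) \<le> (real n - 3) * (D (b 3) - D (a 3) + s)" using q by linarith
  \<comment> \<open>For n = 3 nobody would own the tail, and the inequality reads q \<le> 0.\<close>
  moreover have "0 < real n - 3" using 1 q(1) n3 by (cases "n = 3") auto
  ultimately show ?thesis by simp
qed

text \<open>The part of the third piece from the left that lies in the tail acts as the additional
  participant of \<open>share_N\<close>, whichever player owns it.\<close>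

lemma pieces_long:
  assumes P: "pieces i j k" and t: "3 / 4 \<le> b k"
  shows "D (b k) - D (3 / 4) \<le> 1 / 3 - \<omega> + s"
proof -
  note B = pieces_bounds[OF P]
  have m: "i \<in> {1, 2, 3}" "j \<in> {1, 2, 3}" "k \<in> {1, 2, 3}" using P unfolding pieces_def by blast+
  have mn: "k \<in> {1..n}" using m n3 by auto
  have ak: "N (a k) = 0" using B P N0 unfolding pieces_def by simp
  have nn: "0 \<le> N (b l) - N (a l)" if "l \<in> {1, 2, 3}" for l
    using share_nonneg[of l] that n3 by auto
  have "q * (N (b k) - N (a k)) \<le> 1 / 3 - \<omega> + s"
  proof (rule share_N)
    show "0 \<le> N (b k) - N (a k)" by (rule nn[OF m(3)])
    show "N (b k) - N (a k) - \<epsilon> \<le> N (b l) - N (a l)" if "l \<in> {4..n}" for l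
      by (rule efN[OF mn that])
    have "N (b k) - N (a k) \<le> (N (b 1) - N (a 1)) + (N (b 2) - N (a 2)) + (N (b 3) - N (a 3))"
      using m(3) nn[of 1] nn[of 2] nn[of 3] by auto
    thus "N (b k) - N (a k) + (\<Sum>l=4..n. N (b l) - N (a l)) \<le> 1"
      using sumN split3[of "\<lambda>k. N (b k) - N (a k)"] by simp
  qed
  thus ?thesis using DN[OF t B(4)] DN[of "3/4"] N0[of "3/4"] ak by simp
qed

end

section \<open>Locating the second cut\<close>

lemma shape_near:
  assumes cdf: "has_cdf f F" and sh: "shape k \<kappa> \<delta> \<eta> F" and \<delta>: "0 < \<delta>" "\<delta> \<le> 1 / 16" "10 * \<delta> \<le> \<kappa>"
    and x: "0 \<le> x" "x \<le> 1"
  shows "\<bar>F x - min (4 * x / 3) 1\<bar> \<le> 3 * \<kappa>"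
proof (cases "\<delta> \<le> \<bar>x - 1 / 2\<bar>")
  case True
  thus ?thesis using sh x unfolding shape_def by blast
next
  case False
  have "F (1 / 2 - \<delta>) = 4 * (1 / 2 - \<delta>) / 3 - \<kappa>" "F (1 / 2 + \<delta>) = 4 * (1 / 2 + \<delta>) / 3 - \<kappa>"
    using sh \<delta> unfolding shape_def by auto
  moreover have "F (1 / 2 - \<delta>) \<le> F x" "F x \<le> F (1 / 2 + \<delta>)"
    using False by (auto intro!: has_cdf_mono[OF cdf])
  moreover have "min (4 * x / 3) 1 = 4 * x / 3" "1 / 2 - \<delta> \<le> x" "x \<le> 1 / 2 + \<delta>"
    using False \<delta> by auto
  ultimately have "F x - min (4 * x / 3) 1 \<le> 3 * \<kappa>" "- (F x - min (4 * x / 3) 1) \<le> 3 * \<kappa>"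
    using \<delta> by (simp_all add: field_simps)
  thus ?thesis unfolding abs_le_iff ..
qed

lemma rigid_cdfs_node:
  assumes const: "0 < s" "100 * s \<le> \<kappa>" "0 < \<delta>" "10 * \<delta> \<le> \<kappa>" "200 * \<kappa> \<le> \<omega>" "\<omega> \<le> 1 / 18"
    and \<eta>: "\<eta> \<le> s"
    and p1: "player_cdf \<eta> (9 / 10) f1 F1" "node \<kappa> (1 / 3) \<tau> r F1" "shape (- 2 * \<kappa>) \<kappa> \<delta> \<eta> F1"
    and p2: "player_cdf \<eta> (3 / 5) f2 F2" "node \<kappa> (- (2 / 3)) \<tau> r F2" "shape \<kappa> \<kappa> \<delta> \<eta> F2"
    and \<tau>: "\<bar>\<tau>\<bar> \<le> \<delta>"
    and D: "\<And>x. 0 \<le> x \<Longrightarrow> x \<le> 3 / 4 \<Longrightarrow> D x = 4 / 3 * min x (1 / 2 + \<delta>)"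
  shows "rigid_cdfs F1 F2 D \<kappa> \<delta> s \<omega> \<tau>"
proof
  have c1: "has_cdf f1 F1" and c2: "has_cdf f2 F2" using p1 p2 by (auto simp: player_cdf_def)
  have d: "\<delta> \<le> 1 / 16" using const by linarith
  have top: "1 - s \<le> F x \<and> F x \<le> 1"
    if "3 / 4 \<le> x" "x \<le> 1" "has_cdf f F" "shape k \<kappa> \<delta> \<eta> F" for f F k x
    using has_cdf_mono[OF that(3,1)] has_cdf_mono[OF that(3,2)] has_cdf_1[OF that(3)] that(4) \<eta>
    unfolding shape_def by auto
  fix x y :: real
  show "3 / 4 \<le> x \<Longrightarrow> x \<le> 1 \<Longrightarrow> 1 - s \<le> F1 x \<and> F1 x \<le> 1" by (rule top[OF _ _ c1 p1(3)])
  show "3 / 4 \<le> x \<Longrightarrow> x \<le> 1 \<Longrightarrow> 1 - s \<le> F2 x \<and> F2 x \<le> 1" by (rule top[OF _ _ c2 p2(3)])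
  show "0 \<le> x \<Longrightarrow> x \<le> 1 \<Longrightarrow> \<bar>F1 x - min (4 * x / 3) 1\<bar> \<le> 3 * \<kappa>"
    by (rule shape_near[OF c1 p1(3) const(3) d const(4)])
  show "0 \<le> x \<Longrightarrow> x \<le> 1 \<Longrightarrow> \<bar>F2 x - min (4 * x / 3) 1\<bar> \<le> 3 * \<kappa>"
    by (rule shape_near[OF c2 p2(3) const(3) d const(4)])
  show "3 / 8 \<le> x \<Longrightarrow> x \<le> y \<Longrightarrow> y \<le> 3 / 4 \<Longrightarrow> 9 / 10 * (y - x) \<le> F1 y - F1 x"
    by (rule has_cdf_slope[OF c1]) (use p1 in \<open>auto simp: player_cdf_def\<close>)
  show "3 / 8 \<le> x \<Longrightarrow> x \<le> y \<Longrightarrow> y \<le> 3 / 4 \<Longrightarrow> 3 / 5 * (y - x) \<le> F2 y - F2 x"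
    by (rule has_cdf_slope[OF c2]) (use p2 in \<open>auto simp: player_cdf_def\<close>)
  show "1 / 8 \<le> x \<Longrightarrow> x \<le> 3 / 8 \<Longrightarrow> F1 x = 4 * x / 3 - 2 * \<kappa>"
    "1 / 8 \<le> x \<Longrightarrow> x \<le> 3 / 8 \<Longrightarrow> F2 x = 4 * x / 3 + \<kappa>"
    "7 / 16 \<le> x \<Longrightarrow> x \<le> 9 / 16 \<Longrightarrow> \<delta> \<le> \<bar>x - 1 / 2\<bar> \<Longrightarrow> F1 x = 4 * x / 3 - \<kappa>"
    "7 / 16 \<le> x \<Longrightarrow> x \<le> 9 / 16 \<Longrightarrow> \<delta> \<le> \<bar>x - 1 / 2\<bar> \<Longrightarrow> F2 x = 4 * x / 3 - \<kappa>"
    using p1(3) p2(3) unfolding shape_def by simp_all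
  show "F1 (1 / 2 + \<tau>) = 2 / 3 - \<kappa> + \<tau> / 3" "F2 (1 / 2 + \<tau>) = 2 / 3 - \<kappa> - 2 * \<tau> / 3"
    using p1(2) p2(2) unfolding node_def by simp_all
  show "0 \<le> x \<Longrightarrow> x \<le> 3 / 4 \<Longrightarrow> D x = 4 / 3 * min x (1 / 2 + \<delta>)" by (rule D)
qed (fact const \<tau>)+

lemma three_owners:
  assumes "{i, j, k} = {1, 2, 3::nat}"
  shows "i = 1 \<and> j = 2 \<and> k = 3 \<or> i = 1 \<and> j = 3 \<and> k = 2 \<or> i = 2 \<and> j = 1 \<and> k = 3 \<or>
    i = 2 \<and> j = 3 \<and> k = 1 \<or> i = 3 \<and> j = 1 \<and> k = 2 \<or> i = 3 \<and> j = 2 \<and> k = 1"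
proof -
  have "i \<in> {i, j, k}" "j \<in> {i, j, k}" by simp_all
  hence ij: "i = 1 \<or> i = 2 \<or> i = 3" "j = 1 \<or> j = 2 \<or> j = 3" unfolding assms by simp_all
  have "1 \<in> {i, j, k}" "2 \<in> {i, j, k}" "3 \<in> {i, j, k}" unfolding assms by simp_all
  hence all: "1 = i \<or> 1 = j \<or> 1 = k" "2 = i \<or> 2 = j \<or> 2 = k" "3 = i \<or> 3 = j \<or> 3 = k"
    by simp_all
  from ij show ?thesis by (elim disjE) (use all in simp_all)
qed

lemma (in left_three) second_cut_location:
  assumes P: "pieces i j k"
    and rc: "rigid_cdfs F1 F2 D \<kappa> \<delta> s \<omega> \<tau>"
    and zero: "F1 0 = 0" "F2 0 = 0" "D 0 = 0"
  shows "\<bar>b j - 1 / 2 - \<tau>\<bar> \<le> 10 * s"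
proof -
  interpret rigid_cdfs F1 F2 D \<kappa> \<delta> s \<omega> \<tau> by (rule rc)
  note B = pieces_bounds[OF P]
  have perm: "{i, j, k} = {1, 2, 3}" and ab: "a i = 0" "a j = b i" "a k = b j"
    using P unfolding pieces_def by auto
  have m: "i \<in> {1, 2, 3}" "j \<in> {1, 2, 3}" "k \<in> {1, 2, 3}" using perm by blast+
  have mn: "i \<in> {1..n}" "j \<in> {1..n}" "k \<in> {1..n}" using m n3 by auto
  \<comment> \<open>\<open>T\<close> reads off the position of player \<open>l\<close> in the order
    i, j, k, so that the envy argument is made once for all six orders.\<close>
  define T where "T F l \<longleftrightarrow> (if l = i then takes_left F s (b i) (b j) (b k)
    else if l = j then takes_middle F s (b i) (b j) (b k)
    else takes_right F s (b i) (b j) (b k))" for F l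
  have distinct: "i \<noteq> j" "i \<noteq> k" "j \<noteq> k" using three_owners[OF perm] by (elim disjE; simp)+
  have T: "T F l"
    if e: "\<And>l'. l' \<in> {1..n} \<Longrightarrow> F (b l') - F (a l') - s \<le> F (b l) - F (a l)"
      and F0: "F 0 = 0" and l: "l \<in> {1, 2, 3}" for F l
  proof -
    have "l = i \<or> l = j \<or> l = k" using l perm by blast
    thus ?thesis
      using e[OF mn(1)] e[OF mn(2)] e[OF mn(3)] F0 ab distinct
      unfolding T_def takes_left_def takes_middle_def takes_right_def by auto
  qed
  have e1: "F1 (b l) - F1 (a l) - s \<le> F1 (b 1) - F1 (a 1)" if "l \<in> {1..n}" for l
    using ef1[OF that] eps_le by linarith
  have e2: "F2 (b l) - F2 (a l) - s \<le> F2 (b 2) - F2 (a 2)" if "l \<in> {1..n}" for l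
    using ef2[OF that] eps_le by linarith
  have T1: "T F1 1" by (rule T[OF e1 zero(1)]) auto
  have T2: "T F2 2" by (rule T[OF e2 zero(2)]) auto
  have T3: "T D 3" by (rule T[OF efD zero(3)]) auto
  have owners:
    "takes_left D s (b i) (b j) (b k) \<and> takes_middle F1 s (b i) (b j) (b k) \<and>
      takes_right F2 s (b i) (b j) (b k) \<and> D (b 3) - D (a 3) = D (b i) \<or>
     takes_left D s (b i) (b j) (b k) \<and> takes_middle F2 s (b i) (b j) (b k) \<and>
      takes_right F1 s (b i) (b j) (b k) \<and> D (b 3) - D (a 3) = D (b i) \<or>
     takes_left F1 s (b i) (b j) (b k) \<and> takes_middle D s (b i) (b j) (b k) \<and>
      takes_right F2 s (b i) (b j) (b k) \<and> D (b 3) - D (a 3) = D (b j) - D (b i) \<or>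
     takes_left F2 s (b i) (b j) (b k) \<and> takes_middle D s (b i) (b j) (b k) \<and>
      takes_right F1 s (b i) (b j) (b k) \<and> D (b 3) - D (a 3) = D (b j) - D (b i) \<or>
     takes_left F1 s (b i) (b j) (b k) \<and> takes_middle F2 s (b i) (b j) (b k) \<and>
      takes_right D s (b i) (b j) (b k) \<and> D (b 3) - D (a 3) = D (b k) - D (b j) \<or>
     takes_left F2 s (b i) (b j) (b k) \<and> takes_middle F1 s (b i) (b j) (b k) \<and>
      takes_right D s (b i) (b j) (b k) \<and> D (b 3) - D (a 3) = D (b k) - D (b j)"
    using three_owners[OF perm]
  proof (elim disjE conjE)
    assume "i = 1" "j = 2" "k = 3"
    thus ?thesis using T1 T2 T3 ab unfolding T_def by simp
  next
    assume "i = 1" "j = 3" "k = 2"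
    thus ?thesis using T1 T2 T3 ab unfolding T_def by simp
  next
    assume "i = 2" "j = 1" "k = 3"
    thus ?thesis using T1 T2 T3 ab unfolding T_def by simp
  next
    assume "i = 2" "j = 3" "k = 1"
    thus ?thesis using T1 T2 T3 ab unfolding T_def by simp
  next
    assume "i = 3" "j = 1" "k = 2"
    thus ?thesis using T1 T2 T3 ab zero unfolding T_def by simp
  next
    assume "i = 3" "j = 2" "k = 1"
    thus ?thesis using T1 T2 T3 ab zero unfolding T_def by simp
  qed
  from localise[OF B owners pieces_short[OF P] pieces_long[OF P]]
  have loc: "3 / 4 \<le> b k" "1 / 8 \<le> b i" "b i \<le> 3 / 8" "7 / 16 \<le> b j" "b j \<le> 9 / 16"
    "\<not> takes_right D s (b i) (b j) (b k)" by auto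
  show ?thesis
    by (rule rigid[OF loc(2-5,1) B(4)]) (use owners loc(6) in blast)
qed

section \<open>The adversary\<close>

definition profile ::
    "(real \<Rightarrow> real) \<Rightarrow> (real \<Rightarrow> real) \<Rightarrow> (real \<Rightarrow> real) \<Rightarrow> (real \<Rightarrow> real) \<Rightarrow> nat \<Rightarrow> real \<Rightarrow> real" where
  "profile f1 f2 f3 g i = (if i = 1 then f1 else if i = 2 then f2 else if i = 3 then f3 else g)"

lemma cut_rule_val:
  assumes "cut_rule C" "has_cdf f F" "\<alpha> \<in> {0..1}"
  shows "0 \<le> C i f \<alpha>" "C i f \<alpha> \<le> 1" "F (C i f \<alpha>) = \<alpha>"
proof -
  have "C i f \<alpha> \<in> {0..1} \<and> val f {0..C i f \<alpha>} = \<alpha>"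
    using assms has_cdf_density[OF assms(2)] unfolding cut_rule_def by blast
  thus "0 \<le> C i f \<alpha>" "C i f \<alpha> \<le> 1" "F (C i f \<alpha>) = \<alpha>"
    using has_cdf_val[OF assms(2)] by auto
qed

text \<open>As \<alpha> avoids the vertical range of the square, its preimage under \<open>F\<close>
  lies outside the window. There \<open>G\<close> has the same value, and strict monotonicity of
  \<open>G\<close> leaves no other preimage.\<close>

lemma cut_determined:
  assumes C: "cut_rule C" and \<alpha>: "\<alpha> \<in> {0..1}" and \<eta>: "0 < \<eta>"
    and F: "player_cdf \<eta> c f F" and G: "player_cdf \<eta> c g G"
    and nd: "node \<kappa> m \<tau> r F" and r: "0 < r" "0 \<le> 1 / 2 + \<tau> - r" "1 / 2 + \<tau> + r \<le> 1"
    and ag: "agree_outside \<tau> r F G"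
    and out: "\<alpha> \<le> 2 / 3 - \<kappa> + m * \<tau> - 4 * r / 3 \<or> 2 / 3 - \<kappa> + m * \<tau> + 4 * r / 3 \<le> \<alpha>"
  shows "C i g \<alpha> = C i f \<alpha>"
proof -
  have cf: "has_cdf f F" and cg: "has_cdf g G" using F G by (auto simp: player_cdf_def)
  define y where "y = C i f \<alpha>"
  define z where "z = C i g \<alpha>"
  have y: "0 \<le> y" "y \<le> 1" "F y = \<alpha>" using cut_rule_val[OF C cf \<alpha>] by (auto simp: y_def)
  have z: "0 \<le> z" "z \<le> 1" "G z = \<alpha>" using cut_rule_val[OF C cg \<alpha>] by (auto simp: z_def)
  have "y \<le> 1 / 2 + \<tau> - r \<or> 1 / 2 + \<tau> + r \<le> y"
  proof (rule ccontr)
    assume "\<not> ?thesis"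
    hence "F (1 / 2 + \<tau> - r) < F y" "F y < F (1 / 2 + \<tau> + r)"
      using r y by (auto intro!: player_cdf_strict_mono[OF F \<eta>])
    thus False using out nd y(3) unfolding node_def by auto
  qed
  hence "G y = G z" using ag y z unfolding agree_outside_def by auto
  hence "y = z"
    using player_cdf_strict_mono[OF G \<eta>, of y z] player_cdf_strict_mono[OF G \<eta>, of z y] y z
    by (cases y z rule: linorder_cases) auto
  thus ?thesis by (simp add: y_def z_def)
qed

lemma run_Output_stays:
  assumes "P (run C P v k) = Output A" "k \<le> l"
  shows "run C P v l = run C P v k"
  using assms(2)
proof (induction l rule: dec_induct)
  case (step l)
  with assms(1) show ?case by simp
qed simp

locale adversary =
  fixes n :: nat and C :: "nat \<Rightarrow> (real \<Rightarrow> real) \<Rightarrow> real \<Rightarrow> real" and P :: protocol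
    and \<kappa> \<delta> \<eta> :: real and f3 F3 g N :: "real \<Rightarrow> real"
  assumes n3: "3 \<le> n" and C: "cut_rule C" and P: "rw_protocol n C P"
    and const: "0 < \<kappa>" "\<kappa> \<le> 1 / 1000" "0 < \<delta>" "\<delta> \<le> 1 / 16" "0 < \<eta>" "\<eta> \<le> \<kappa>"
    and f3: "has_cdf f3 F3" and g: "has_cdf g N"
begin

text \<open>Inside the window only the density bounds restrict a candidate, not \<open>node\<close>.
  Hence all later refinements remain candidates, and a claim about all candidates covers both ways
  to continue.\<close>

definition candidates ::
    "real \<Rightarrow> real \<Rightarrow> (real \<Rightarrow> real) \<Rightarrow> (real \<Rightarrow> real) \<Rightarrow> (nat \<Rightarrow> real \<Rightarrow> real) set" where
  "candidates \<tau> r F1 F2 = {v. \<exists>f1 G1 f2 G2. v = profile f1 f2 f3 g \<and>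
     player_cdf \<eta> (9 / 10) f1 G1 \<and> player_cdf \<eta> (3 / 5) f2 G2 \<and>
     agree_outside \<tau> r F1 G1 \<and> agree_outside \<tau> r F2 G2}"

definition node2 ::
    "real \<Rightarrow> real \<Rightarrow> (real \<Rightarrow> real) \<Rightarrow> (real \<Rightarrow> real) \<Rightarrow> (real \<Rightarrow> real) \<Rightarrow> (real \<Rightarrow> real) \<Rightarrow> bool" where
  "node2 \<tau> r f1 F1 f2 F2 \<longleftrightarrow> 0 < r \<and> \<bar>\<tau>\<bar> + r \<le> \<delta> \<and>
     player_cdf \<eta> (9 / 10) f1 F1 \<and> node \<kappa> (1 / 3) \<tau> r F1 \<and> shape (- 2 * \<kappa>) \<kappa> \<delta> \<eta> F1 \<and>
     player_cdf \<eta> (3 / 5) f2 F2 \<and> node \<kappa> (- (2 / 3)) \<tau> r F2 \<and> shape \<kappa> \<kappa> \<delta> \<eta> F2"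

lemma candidate_instance: "v \<in> candidates \<tau> r F1 F2 \<Longrightarrow> cake_instance n v"
  unfolding candidates_def cake_instance_def profile_def player_cdf_def
  using has_cdf_density f3 g by auto

lemma node2_root: "\<exists>f1 F1 f2 F2. node2 0 \<delta> f1 F1 f2 F2"
proof -
  obtain f1 F1 where "player_cdf \<eta> (9 / 10) f1 F1 \<and> shape (- 2 * \<kappa>) \<kappa> \<delta> \<eta> F1 \<and> node \<kappa> (1 / 3) 0 \<delta> F1"
    using root_player[OF disjI1[OF refl] const order_refl] by blast
  moreover obtain f2 F2 where "player_cdf \<eta> (3 / 5) f2 F2 \<and> shape \<kappa> \<kappa> \<delta> \<eta> F2 \<and> node \<kappa> (- (2 / 3)) 0 \<delta> F2"
  proof -
    have "(3 / 5 :: real) \<le> 9 / 10" by simp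
    from root_player[OF disjI2[OF refl] const this] that show ?thesis by blast
  qed
  ultimately show ?thesis unfolding node2_def using const by (metis abs_zero add_0 order_refl)
qed

lemma node2_child:
  assumes nd: "node2 \<tau> r f1 F1 f2 F2" and \<sigma>: "\<sigma> = 1 \<or> \<sigma> = - 1"
  shows "\<exists>f1' F1' f2' F2'. node2 (\<tau> + \<sigma> * r / 2) (r / 8) f1' F1' f2' F2' \<and>
    agree_outside \<tau> r F1 F1' \<and> agree_outside \<tau> r F2 F2'"
proof -
  have r: "0 < r" "\<bar>\<tau>\<bar> + r \<le> 1 / 16" "\<bar>\<tau>\<bar> + r \<le> \<delta>" and \<eta>: "\<eta> \<le> 3 / 5"
    using nd const unfolding node2_def by auto
  obtain f1' F1' where 1: "player_cdf \<eta> (9 / 10) f1' F1'"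
    "node \<kappa> (1 / 3) (\<tau> + \<sigma> * r / 2) (r / 8) F1'" "agree_outside \<tau> r F1 F1'"
    using node_child[OF _ _ r(1,2) \<sigma> _ \<eta>, of "9/10" f1 F1 \<kappa> "1/3"] nd unfolding node2_def by auto
  obtain f2' F2' where 2: "player_cdf \<eta> (3 / 5) f2' F2'"
    "node \<kappa> (- (2 / 3)) (\<tau> + \<sigma> * r / 2) (r / 8) F2'" "agree_outside \<tau> r F2 F2'"
    using node_child[OF _ _ r(1,2) \<sigma> _ \<eta>, of "3/5" f2 F2 \<kappa> "- (2/3)"] nd unfolding node2_def by auto
  have "shape (- 2 * \<kappa>) \<kappa> \<delta> \<eta> F1'" "shape \<kappa> \<kappa> \<delta> \<eta> F2'"
    using shape_agree[OF _ 1(3) r(3) const(4)] shape_agree[OF _ 2(3) r(3) const(4)] nd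
    unfolding node2_def by auto
  moreover have "\<bar>\<tau> + \<sigma> * r / 2\<bar> + r / 8 \<le> \<delta>" using \<sigma> r by auto
  ultimately show ?thesis unfolding node2_def using 1 2 r(1) by (metis divide_pos_pos zero_less_numeral)
qed

lemma candidates_child:
  assumes "agree_outside \<tau> r F1 F1'" "agree_outside \<tau> r F2 F2'"
    and "0 < r" "\<sigma> = 1 \<or> \<sigma> = - 1"
  shows "candidates (\<tau> + \<sigma> * r / 2) (r / 8) F1' F2' \<subseteq> candidates \<tau> r F1 F2"
proof -
  have "\<bar>\<tau> + \<sigma> * r / 2 - \<tau>\<bar> + r / 8 \<le> r" using assms by auto
  thus ?thesis unfolding candidates_def
    using agree_outside_trans[OF assms(1)] agree_outside_trans[OF assms(2)] by blast
qed

lemma node2_candidate: "node2 \<tau> r f1 F1 f2 F2 \<Longrightarrow> profile f1 f2 f3 g \<in> candidates \<tau> r F1 F2"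
  unfolding node2_def candidates_def using agree_outside_refl by blast

text \<open>The two possible new squares project to disjoint intervals on the vertical axis as well,
  because \<open>\<bar>m\<bar> \<ge> 1/3\<close>; the radius \<open>r/8\<close> is small enough for this.\<close>

lemma choose_side:
  fixes m \<tau> r \<alpha> :: real
  assumes "m = 1 / 3 \<or> m = - (2 / 3)" "0 < r"
  shows "\<exists>\<sigma>. (\<sigma> = 1 \<or> \<sigma> = - 1) \<and>
    (\<alpha> \<le> 2 / 3 - \<kappa> + m * (\<tau> + \<sigma> * r / 2) - 4 * (r / 8) / 3 \<or>
     2 / 3 - \<kappa> + m * (\<tau> + \<sigma> * r / 2) + 4 * (r / 8) / 3 \<le> \<alpha>)"
proof (cases "\<alpha> \<le> 2 / 3 - \<kappa> + m * \<tau>")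
  case True
  define \<sigma> :: real where "\<sigma> = (if m = 1 / 3 then 1 else - 1)"
  have "0 \<le> m * \<sigma> * r / 2 - 4 * (r / 8) / 3" using assms by (auto simp: \<sigma>_def)
  hence "\<alpha> \<le> 2 / 3 - \<kappa> + m * (\<tau> + \<sigma> * r / 2) - 4 * (r / 8) / 3"
    using True by (simp add: algebra_simps)
  moreover have "\<sigma> = 1 \<or> \<sigma> = - 1" by (simp add: \<sigma>_def)
  ultimately show ?thesis by blast
next
  case False
  define \<sigma> :: real where "\<sigma> = (if m = 1 / 3 then - 1 else 1)"
  have "m * \<sigma> * r / 2 + 4 * (r / 8) / 3 \<le> 0" using assms by (auto simp: \<sigma>_def)
  hence "2 / 3 - \<kappa> + m * (\<tau> + \<sigma> * r / 2) + 4 * (r / 8) / 3 \<le> \<alpha>"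
    using False by (simp add: algebra_simps)
  moreover have "\<sigma> = 1 \<or> \<sigma> = - 1" by (simp add: \<sigma>_def)
  ultimately show ?thesis by blast
qed

text \<open>The side is chosen from the query before any child is built: a \<open>Cut\<close> value
  must miss the vertical range of the new square of the player asked, an \<open>Eval\<close> point
  its horizontal range. Both players move to the same side and so keep a common \<tau>.\<close>

lemma answer_fixed:
  assumes nd: "node2 \<tau> r f1 F1 f2 F2"
    and legal: "\<forall>i \<alpha>. q = Cut i \<alpha> \<longrightarrow> \<alpha> \<in> {0..1}"
  shows "\<exists>\<tau>' f1' F1' f2' F2' y. node2 \<tau>' (r / 8) f1' F1' f2' F2' \<and>
    candidates \<tau>' (r / 8) F1' F2' \<subseteq> candidates \<tau> r F1 F2 \<and>
    (\<forall>v \<in> candidates \<tau>' (r / 8) F1' F2'. answer C v q = y)"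
proof -
  have r: "0 < r" "\<bar>\<tau>\<bar> + r \<le> \<delta>" using nd unfolding node2_def by auto
  have "\<exists>\<sigma>. (\<sigma> = 1 \<or> \<sigma> = - 1) \<and>
    (\<forall>f1' F1' f2' F2'. node2 (\<tau> + \<sigma> * r / 2) (r / 8) f1' F1' f2' F2' \<longrightarrow>
      (\<exists>y. \<forall>v \<in> candidates (\<tau> + \<sigma> * r / 2) (r / 8) F1' F2'. answer C v q = y))"
  proof (cases q)
    case q: (Cut i \<alpha>)
    have \<alpha>: "\<alpha> \<in> {0..1}" using legal q by blast
    \<comment> \<open>For a player other than 1 and 2 all candidates have the same density, so
      either side will do and -2/3 serves as a default.\<close>
    define m :: real where "m = (if i = 1 then 1 / 3 else - (2 / 3))"
    have m: "m = 1 / 3 \<or> m = - (2 / 3)" by (simp add: m_def)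
    obtain \<sigma> where \<sigma>: "\<sigma> = 1 \<or> \<sigma> = - 1" and
      out: "\<alpha> \<le> 2 / 3 - \<kappa> + m * (\<tau> + \<sigma> * r / 2) - 4 * (r / 8) / 3 \<or>
        2 / 3 - \<kappa> + m * (\<tau> + \<sigma> * r / 2) + 4 * (r / 8) / 3 \<le> \<alpha>"
      using choose_side[OF _ r(1), of m \<alpha> \<tau>] m by blast
    have "answer C v q = C i (profile f1' f2' f3 g i) \<alpha>"
      if nd': "node2 (\<tau> + \<sigma> * r / 2) (r / 8) f1' F1' f2' F2'"
        and v: "v \<in> candidates (\<tau> + \<sigma> * r / 2) (r / 8) F1' F2'" for v f1' F1' f2' F2'
    proof -
      obtain h1 G1 h2 G2 where v': "v = profile h1 h2 f3 g" and
        h: "player_cdf \<eta> (9 / 10) h1 G1" "player_cdf \<eta> (3 / 5) h2 G2"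
        "agree_outside (\<tau> + \<sigma> * r / 2) (r / 8) F1' G1"
        "agree_outside (\<tau> + \<sigma> * r / 2) (r / 8) F2' G2"
        using v unfolding candidates_def by blast
      have r': "0 < r / 8" "0 \<le> 1 / 2 + (\<tau> + \<sigma> * r / 2) - r / 8" "1 / 2 + (\<tau> + \<sigma> * r / 2) + r / 8 \<le> 1"
        using nd' const unfolding node2_def by auto
      have 1: "C i h1 \<alpha> = C i f1' \<alpha>" if "i = 1"
        by (rule cut_determined[OF C \<alpha> const(5) _ h(1) _ r' h(3), where m = "1/3" and \<kappa> = \<kappa>])
           (use nd' out that in \<open>auto simp: node2_def m_def\<close>)
      have 2: "C i h2 \<alpha> = C i f2' \<alpha>" if "i = 2"
        by (rule cut_determined[OF C \<alpha> const(5) _ h(2) _ r' h(4), where m = "- (2/3)" and \<kappa> = \<kappa>])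
           (use nd' out that in \<open>auto simp: node2_def m_def\<close>)
      show ?thesis using 1 2 by (simp add: q v' profile_def)
    qed
    thus ?thesis using \<sigma> by blast
  next
    case q: (Eval i x)
    define \<sigma> :: real where "\<sigma> = (if x \<le> 1 / 2 + \<tau> then 1 else - 1)"
    have \<sigma>: "\<sigma> = 1 \<or> \<sigma> = - 1" by (simp add: \<sigma>_def)
    have out: "x \<le> 1 / 2 + (\<tau> + \<sigma> * r / 2) - r / 8 \<or> 1 / 2 + (\<tau> + \<sigma> * r / 2) + r / 8 \<le> x"
      using r by (auto simp: \<sigma>_def)
    have "answer C v q = val (profile f1' f2' f3 g i) {0..x}"
      if nd': "node2 (\<tau> + \<sigma> * r / 2) (r / 8) f1' F1' f2' F2'"
        and v: "v \<in> candidates (\<tau> + \<sigma> * r / 2) (r / 8) F1' F2'" for v f1' F1' f2' F2'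
    proof -
      obtain h1 G1 h2 G2 where v': "v = profile h1 h2 f3 g" and
        h: "has_cdf h1 G1" "has_cdf h2 G2"
        "agree_outside (\<tau> + \<sigma> * r / 2) (r / 8) F1' G1"
        "agree_outside (\<tau> + \<sigma> * r / 2) (r / 8) F2' G2"
        using v unfolding candidates_def player_cdf_def by blast
      have "has_cdf f1' F1'" "has_cdf f2' F2'" using nd' unfolding node2_def player_cdf_def by auto
      moreover have "G1 x = F1' x" "G2 x = F2' x" using h out unfolding agree_outside_def by blast+
      ultimately show ?thesis using h
        by (simp add: q v' profile_def has_cdf_val)
    qed
    thus ?thesis using \<sigma> by blast
  qed
  then obtain \<sigma> where \<sigma>: "\<sigma> = 1 \<or> \<sigma> = - 1"
    and fixed: "\<And>f1' F1' f2' F2'. node2 (\<tau> + \<sigma> * r / 2) (r / 8) f1' F1' f2' F2' \<Longrightarrow>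
      \<exists>y. \<forall>v \<in> candidates (\<tau> + \<sigma> * r / 2) (r / 8) F1' F2'. answer C v q = y" by blast
  obtain f1' F1' f2' F2' where ch: "node2 (\<tau> + \<sigma> * r / 2) (r / 8) f1' F1' f2' F2'"
    and ag: "agree_outside \<tau> r F1 F1'" "agree_outside \<tau> r F2 F2'"
    using node2_child[OF nd \<sigma>] by blast
  from candidates_child[OF ag r(1) \<sigma>] fixed[OF ch] ch show ?thesis by blast
qed

lemma same_history:
  "\<exists>\<tau> f1 F1 f2 F2 h. node2 \<tau> (\<delta> / 8 ^ k) f1 F1 f2 F2 \<and>
    (\<forall>v \<in> candidates \<tau> (\<delta> / 8 ^ k) F1 F2. run C P v k = h)"
proof (induction k)
  case 0
  obtain f1 F1 f2 F2 where "node2 0 (\<delta> / 8 ^ 0) f1 F1 f2 F2" using node2_root by auto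
  moreover have "\<forall>v \<in> candidates 0 (\<delta> / 8 ^ 0) F1 F2. run C P v 0 = []" by simp
  ultimately show ?case by blast
next
  case (Suc k)
  then obtain \<tau> f1 F1 f2 F2 h where nd: "node2 \<tau> (\<delta> / 8 ^ k) f1 F1 f2 F2"
    and h: "\<And>v. v \<in> candidates \<tau> (\<delta> / 8 ^ k) F1 F2 \<Longrightarrow> run C P v k = h" by blast
  have r: "\<delta> / 8 ^ k / 8 = \<delta> / 8 ^ Suc k" by simp
  \<comment> \<open>After an output the history no longer changes. The dummy query
    \<open>Eval 0 0\<close> lets the refinement go on, so that the radius is \<delta> / 8 ^ k in
    every case.\<close>
  define q where "q = (case P h of Ask q \<Rightarrow> q | Output A \<Rightarrow> Eval 0 0)"
  have legal: "\<forall>i \<alpha>. q = Cut i \<alpha> \<longrightarrow> \<alpha> \<in> {0..1}"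
  proof (intro allI impI)
    fix i \<alpha> assume that: "q = Cut i \<alpha>"
    \<comment> \<open>Since all candidates share the history, a single one of them shows that the
      next query is legal.\<close>
    let ?v = "profile f1 f2 f3 g"
    have v: "?v \<in> candidates \<tau> (\<delta> / 8 ^ k) F1 F2" by (rule node2_candidate[OF nd])
    have "P h = Ask q" using that unfolding q_def by (auto split: action.splits)
    moreover have "legal_action n (run C P ?v k) (P (run C P ?v k))"
      using P candidate_instance[OF v] unfolding rw_protocol_def by blast
    ultimately show "\<alpha> \<in> {0..1}" using that h[OF v] by simp
  qed
  from answer_fixed[OF nd legal, unfolded r]
  obtain \<tau>' f1' F1' f2' F2' y where nd': "node2 \<tau>' (\<delta> / 8 ^ Suc k) f1' F1' f2' F2'"
    and sub: "candidates \<tau>' (\<delta> / 8 ^ Suc k) F1' F2' \<subseteq> candidates \<tau> (\<delta> / 8 ^ k) F1 F2"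
    and y: "\<And>v. v \<in> candidates \<tau>' (\<delta> / 8 ^ Suc k) F1' F2' \<Longrightarrow> answer C v q = y" by blast
  have "run C P v (Suc k) = (case P h of Ask q' \<Rightarrow> h @ [(q, y)] | Output A \<Rightarrow> h)"
    if v: "v \<in> candidates \<tau>' (\<delta> / 8 ^ Suc k) F1' F2'" for v
  proof -
    have "run C P v k = h" using h v sub by blast
    thus ?thesis using y[OF v] by (cases "P h") (auto simp: q_def)
  qed
  thus ?case using nd' by blast
qed

section \<open>Two indistinguishable instances\<close>

lemma left_three_candidate:
  assumes nd: "node2 \<tau> r f1 F1 f2 F2"
    and A: "connected_allocation n A" and ef: "envy_free n (profile f1 f2 f3 g) \<epsilon> A"
    and ab: "\<And>i. i \<in> {1..n} \<Longrightarrow>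
      0 \<le> a i \<and> a i \<le> b i \<and> b i \<le> 1 \<and> {a i<..<b i} \<subseteq> A i \<and> A i \<subseteq> {a i..b i}"
    and \<epsilon>: "0 < \<epsilon>" "\<eta> = \<epsilon>"
    and \<sigma>: "\<sigma> = 4 / 3 * (1 / 2 + \<delta>)" and q: "q = (2 * real n - 5) / 6" and \<omega>: "\<omega> = 1 / (6 * real n)"
    and s: "s = real n * \<epsilon>" "real n * s < \<omega>"
    and D: "\<And>x. 0 \<le> x \<and> x \<le> 3 / 4 \<Longrightarrow> (\<sigma> + q) * F3 x = 4 / 3 * min x (1 / 2 + \<delta>)"
      "\<And>x. 3 / 4 \<le> x \<and> x \<le> 1 \<Longrightarrow> (\<sigma> + q) * F3 x = \<sigma> + q * (4 * x - 3)"
    and N: "\<And>x. x \<le> 3 / 4 \<Longrightarrow> N x = 0" "\<And>x. 3 / 4 \<le> x \<and> x \<le> 1 \<Longrightarrow> N x = 4 * x - 3"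
  shows "left_three n a b F1 F2 (\<lambda>x. (\<sigma> + q) * F3 x) N \<epsilon> s \<omega> \<sigma> q"
proof -
  have al: "allocation n A" using A by (simp add: connected_allocation_def)
  interpret interval_division n a b by (rule allocation_interval_division[OF al ab])
  have c1: "has_cdf f1 F1" and c2: "has_cdf f2 F2" using nd by (auto simp: node2_def player_cdf_def)
  have envy: "F (b j) - F (a j) - \<epsilon> \<le> F (b i) - F (a i)"
    if "has_cdf (profile f1 f2 f3 g i) F" "i \<in> {1..n}" "j \<in> {1..n}" for i j F
  proof -
    have "val (profile f1 f2 f3 g i) (A l) = F (b l) - F (a l)" if "l \<in> {1..n}" for l
      using ab[OF that] by (intro has_cdf_has_integral_between(2)[OF \<open>has_cdf _ F\<close>]) auto
    moreover have "val (profile f1 f2 f3 g i) (A j) - \<epsilon> \<le> val (profile f1 f2 f3 g i) (A i)"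
      using ef that(2,3) unfolding envy_free_def by blast
    ultimately show ?thesis using that(2,3) by simp
  qed
  have n': "3 \<le> real n" using n3 by simp
  \<comment> \<open>The bound \<sigma> + q \<le> n makes s = n * \<epsilon> large enough for the
    envy of player 3 after scaling.\<close>
  have H: "0 < \<sigma> + q" "\<sigma> + q \<le> real n"
    using const n' unfolding \<sigma> q by (auto simp: field_simps)
  have w: "0 < \<omega>" "\<omega> \<le> 1 / 18" "real n * \<omega> = 1 / 6"
    using n' by (auto simp: \<omega> field_simps)
  show ?thesis
  proof
    show "3 \<le> n" by (rule n3)
    show "F1 x \<le> F1 y" "F2 x \<le> F2 y" "N x \<le> N y" "(\<sigma> + q) * F3 x \<le> (\<sigma> + q) * F3 y"
      if "x \<le> y" for x y
      using that has_cdf_mono[OF c1] has_cdf_mono[OF c2] has_cdf_mono[OF f3] has_cdf_mono[OF g] H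
      by auto
    show "(\<Sum>i=1..n. F1 (b i) - F1 (a i)) = 1" by (rule allocation_sum[OF al ab c1])
    show "(\<Sum>i=1..n. F2 (b i) - F2 (a i)) = 1" by (rule allocation_sum[OF al ab c2])
    show "(\<Sum>i=1..n. N (b i) - N (a i)) = 1" by (rule allocation_sum[OF al ab g])
    show "(\<Sum>i=1..n. (\<sigma> + q) * F3 (b i) - (\<sigma> + q) * F3 (a i)) = \<sigma> + q"
      using allocation_sum[OF al ab f3]
      by (simp add: right_diff_distrib[symmetric] sum_distrib_left[symmetric])
    show "F1 (b i) - F1 (a i) - \<epsilon> \<le> F1 (b 1) - F1 (a 1)" if "i \<in> {1..n}" for i
      by (rule envy) (use that c1 n3 in \<open>auto simp: profile_def\<close>)
    show "F2 (b i) - F2 (a i) - \<epsilon> \<le> F2 (b 2) - F2 (a 2)" if "i \<in> {1..n}" for i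
      by (rule envy) (use that c2 n3 in \<open>auto simp: profile_def\<close>)
    show "N (b i) - N (a i) - \<epsilon> \<le> N (b k) - N (a k)" if "i \<in> {1..n}" "k \<in> {4..n}" for i k
      by (rule envy) (use that g in \<open>auto simp: profile_def\<close>)
    show "(\<sigma> + q) * F3 (b i) - (\<sigma> + q) * F3 (a i) - s \<le> (\<sigma> + q) * F3 (b 3) - (\<sigma> + q) * F3 (a 3)"
      if "i \<in> {1..n}" for i
    proof -
      have "F3 (b i) - F3 (a i) - \<epsilon> \<le> F3 (b 3) - F3 (a 3)"
        by (rule envy) (use that f3 n3 in \<open>auto simp: profile_def\<close>)
      hence "(\<sigma> + q) * (F3 (b i) - F3 (a i) - \<epsilon>) \<le> (\<sigma> + q) * (F3 (b 3) - F3 (a 3))"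
        using H by simp
      moreover have "(\<sigma> + q) * \<epsilon> \<le> s" unfolding s using H \<epsilon> by simp
      ultimately show ?thesis by (simp add: algebra_simps)
    qed
    show "1 - \<epsilon> \<le> F1 (3 / 4)" "1 - \<epsilon> \<le> F2 (3 / 4)"
      using nd \<epsilon>(2) unfolding node2_def shape_def by simp_all
    show "F1 x \<le> 1" "F2 x \<le> 1" if "x \<le> 1" for x
      using has_cdf_mono[OF c1 that] has_cdf_mono[OF c2 that] has_cdf_1[OF c1] has_cdf_1[OF c2] by auto
    show "N x = 0" if "x \<le> 3 / 4" for x using N that by auto
    show "(\<sigma> + q) * F3 x = \<sigma> + q * N x" if "3 / 4 \<le> x" "x \<le> 1" for x using D N that by auto
    show "2 / 3 \<le> \<sigma>" using const by (simp add: \<sigma>)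
    show "0 < q" "q \<le> real n" using n' by (auto simp: q)
    \<comment> \<open>\<open>q\<close> is the midpoint of (n - 3)/3 and (n - 2)/3, and n * \<omega>
      = 1/6 is its distance to both.\<close>
    have "(real n - 3) * (1 / 3 + \<omega>) = (real n - 3) / 3 + real n * \<omega> - 3 * \<omega>"
      by (simp add: field_simps)
    thus "(real n - 3) * (1 / 3 + \<omega>) \<le> q" using w(1) unfolding w(3) q by (simp add: field_simps)
    have "(real n - 2) * (1 / 3 - \<omega>) = (real n - 2) / 3 - real n * \<omega> + 2 * \<omega>"
      by (simp add: field_simps)
    thus "q \<le> (real n - 2) * (1 / 3 - \<omega>)" using w(1) unfolding w(3) q by (simp add: field_simps)
    show "0 < \<epsilon>" "s = real n * \<epsilon>" "real n * s < \<omega>" "\<omega> \<le> 1 / 18" using \<epsilon> s w by auto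
    have "(real n + \<sigma> + q) * s \<le> (2 * real n) * s"
      using H s \<epsilon> n' by (intro mult_right_mono) auto
    thus "(real n + \<sigma> + q) * s < 1 / 2" using s w by simp
  qed
qed

text \<open>If K queries always sufficed, all candidates after K rounds would get the same
  allocation. The children at \<tau> \<plusminus> r/2 are both candidates, and each forces the same
  cut \<open>b j\<close> to within 10s of its own centre. So r \<le> 20s, against the choice of
  K.\<close>

lemma many_queries:
  assumes comp: "computes_connected_envy_free n \<epsilon> C P"
    and \<epsilon>: "0 < \<epsilon>" "\<eta> = \<epsilon>"
    and \<sigma>: "\<sigma> = 4 / 3 * (1 / 2 + \<delta>)" and q: "q = (2 * real n - 5) / 6" and \<omega>: "\<omega> = 1 / (6 * real n)"
    and s: "s = real n * \<epsilon>" "real n * s < \<omega>" "100 * s \<le> \<kappa>" "10 * \<delta> \<le> \<kappa>" "200 * \<kappa> \<le> \<omega>"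
    and D: "\<And>x. 0 \<le> x \<and> x \<le> 3 / 4 \<Longrightarrow> (\<sigma> + q) * F3 x = 4 / 3 * min x (1 / 2 + \<delta>)"
      "\<And>x. 3 / 4 \<le> x \<and> x \<le> 1 \<Longrightarrow> (\<sigma> + q) * F3 x = \<sigma> + q * (4 * x - 3)"
    and N: "\<And>x. x \<le> 3 / 4 \<Longrightarrow> N x = 0" "\<And>x. 3 / 4 \<le> x \<and> x \<le> 1 \<Longrightarrow> N x = 4 * x - 3"
    and K: "20 * s < \<delta> / 8 ^ K"
  shows "\<exists>v. cake_instance n v \<and> K < num_queries C P v"
proof (rule ccontr)
  assume contra: "\<not> ?thesis"
  define r where "r = \<delta> / 8 ^ K"
  obtain \<tau> f1 F1 f2 F2 h where nd: "node2 \<tau> r f1 F1 f2 F2"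
    and h: "\<And>v. v \<in> candidates \<tau> r F1 F2 \<Longrightarrow> run C P v K = h"
    using same_history[of K] unfolding r_def by blast
  have halts: "\<exists>A. P h = Output A \<and> connected_allocation n A \<and> envy_free n v \<epsilon> A"
    if v: "v \<in> candidates \<tau> r F1 F2" for v
  proof -
    have inst: "cake_instance n v" by (rule candidate_instance[OF v])
    then obtain A k where A: "connected_allocation n A" "envy_free n v \<epsilon> A"
      and k: "P (run C P v k) = Output A"
      using comp unfolding computes_connected_envy_free_def outputs_def by blast
    \<comment> \<open>\<open>k0\<close> is the first time of output. The run is constant from then
      on, so the output can be read off the common history \<open>h\<close>, and it is the
      allocation \<open>A\<close>.\<close>
    define k0 where "k0 = num_queries C P v"
    have "\<exists>A. P (run C P v k0) = Output A"
      unfolding k0_def num_queries_def by (rule LeastI[of _ k]) (use k in blast)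
    then obtain A' where A': "P (run C P v k0) = Output A'" by blast
    have "k0 \<le> K" using contra inst by (auto simp: k0_def)
    hence "P h = Output A'" using run_Output_stays[where P = P, OF A', of K] A' h[OF v] by simp
    moreover have "k0 \<le> k" unfolding k0_def num_queries_def by (rule Least_le) (use k in blast)
    hence "A' = A" using run_Output_stays[where P = P, OF A', of k] A' k by simp
    ultimately show ?thesis using A by blast
  qed
  have w: "\<omega> \<le> 1 / 18" using n3 by (auto simp: \<omega> field_simps)
  have sp: "0 < s" using s \<epsilon> n3 by simp
  have \<eta>s: "\<eta> \<le> s"
  proof -
    have "1 * \<epsilon> \<le> real n * \<epsilon>" using n3 \<epsilon> by (intro mult_right_mono) auto
    thus ?thesis using s \<epsilon> by simp
  qed
  from halts[OF node2_candidate[OF nd]] obtain A where PA: "P h = Output A"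
    and A: "connected_allocation n A" by blast
  obtain a b where ab: "\<And>i. i \<in> {1..n} \<Longrightarrow>
      0 \<le> a i \<and> a i \<le> b i \<and> b i \<le> 1 \<and> {a i<..<b i} \<subseteq> A i \<and> A i \<subseteq> {a i..b i}"
    using connected_allocation_endpoints[OF A] by blast
  have side: "left_three n a b F1' F2' (\<lambda>x. (\<sigma> + q) * F3 x) N \<epsilon> s \<omega> \<sigma> q \<and>
      rigid_cdfs F1' F2' (\<lambda>x. (\<sigma> + q) * F3 x) \<kappa> \<delta> s \<omega> (\<tau> + \<rho> * r / 2) \<and> F1' 0 = 0 \<and> F2' 0 = 0"
    if nd': "node2 (\<tau> + \<rho> * r / 2) (r / 8) f1' F1' f2' F2'"
      and ag: "agree_outside \<tau> r F1 F1'" "agree_outside \<tau> r F2 F2'"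
      and \<rho>: "\<rho> = 1 \<or> \<rho> = - 1" for \<rho> f1' F1' f2' F2'
  proof -
    have r: "0 < r" using nd by (simp add: node2_def)
    have "profile f1' f2' f3 g \<in> candidates \<tau> r F1 F2"
      using node2_candidate[OF nd'] candidates_child[OF ag r \<rho>] by blast
    from halts[OF this] PA have "envy_free n (profile f1' f2' f3 g) \<epsilon> A" by auto
    from left_three_candidate[OF nd' A this ab \<epsilon> \<sigma> q \<omega> s(1,2) D N]
    have "left_three n a b F1' F2' (\<lambda>x. (\<sigma> + q) * F3 x) N \<epsilon> s \<omega> \<sigma> q" .
    moreover have "rigid_cdfs F1' F2' (\<lambda>x. (\<sigma> + q) * F3 x) \<kappa> \<delta> s \<omega> (\<tau> + \<rho> * r / 2)"
    proof (rule rigid_cdfs_node)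
      show "player_cdf \<eta> (9 / 10) f1' F1'" "node \<kappa> (1 / 3) (\<tau> + \<rho> * r / 2) (r / 8) F1'"
        "shape (- 2 * \<kappa>) \<kappa> \<delta> \<eta> F1'" "player_cdf \<eta> (3 / 5) f2' F2'"
        "node \<kappa> (- (2 / 3)) (\<tau> + \<rho> * r / 2) (r / 8) F2'" "shape \<kappa> \<kappa> \<delta> \<eta> F2'"
        "\<bar>\<tau> + \<rho> * r / 2\<bar> \<le> \<delta>" using nd' unfolding node2_def by auto
    qed (use sp s const w \<eta>s D in auto)
    moreover have "F1' 0 = 0" "F2' 0 = 0"
      using nd' has_cdf_0 unfolding node2_def player_cdf_def by blast+
    ultimately show ?thesis by blast
  qed
  obtain f1' F1' f2' F2' where R: "node2 (\<tau> + 1 * r / 2) (r / 8) f1' F1' f2' F2'"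
    "agree_outside \<tau> r F1 F1'" "agree_outside \<tau> r F2 F2'" using node2_child[OF nd, of 1] by blast
  obtain g1' G1' g2' G2' where L: "node2 (\<tau> + (- 1) * r / 2) (r / 8) g1' G1' g2' G2'"
    "agree_outside \<tau> r F1 G1'" "agree_outside \<tau> r F2 G2'" using node2_child[OF nd, of "- 1"] by blast
  note R' = side[OF R disjI1[OF refl]] and L' = side[OF L disjI2[OF refl]]
  have D0: "(\<sigma> + q) * F3 0 = 0" using has_cdf_0[OF f3] by simp
  interpret right: left_three n a b F1' F2' "\<lambda>x. (\<sigma> + q) * F3 x" N \<epsilon> s \<omega> \<sigma> q using R' by blast
  interpret left: left_three n a b G1' G2' "\<lambda>x. (\<sigma> + q) * F3 x" N \<epsilon> s \<omega> \<sigma> q using L' by blast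
  \<comment> \<open>\<open>pieces\<close> refers to the endpoints \<open>a\<close> and
    \<open>b\<close> only, so the order found for one instance serves for the other.\<close>
  obtain i j k where P: "right.pieces i j k" using right.pieces_exist by blast
  have "\<bar>b j - 1 / 2 - (\<tau> + 1 * r / 2)\<bar> \<le> 10 * s"
    by (rule right.second_cut_location[OF P]) (use R' D0 in auto)
  moreover have "\<bar>b j - 1 / 2 - (\<tau> + (- 1) * r / 2)\<bar> \<le> 10 * s"
    by (rule left.second_cut_location[OF P]) (use L' D0 in auto)
  ultimately have "r \<le> 20 * s" by simp
  thus False using K by (simp add: r_def)
qed

end

section \<open>Choice of the constants and the logarithmic bound\<close>

theorem theorem4p3:
  fixes n :: nat
  assumes "n \<ge> 3"
  shows "\<exists>c \<epsilon>\<^sub>0 :: real. c > 0 \<and> 0 < \<epsilon>\<^sub>0 \<and> \<epsilon>\<^sub>0 < 1 \<and>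
    (\<forall>\<epsilon> C P. 0 < \<epsilon> \<longrightarrow> \<epsilon> < \<epsilon>\<^sub>0 \<longrightarrow> cut_rule C \<longrightarrow> rw_protocol n C P \<longrightarrow>
       computes_connected_envy_free n \<epsilon> C P \<longrightarrow>
       (\<exists>v. cake_instance n v \<and> c * ln (1 / \<epsilon>) \<le> real (num_queries C P v)))"
proof -
  have n: "3 \<le> real n" using assms by simp
  define \<omega> :: real where "\<omega> = 1 / (6 * real n)"
  define \<kappa> where "\<kappa> = \<omega> / 200"
  define \<delta> where "\<delta> = \<kappa> / 10"
  define \<sigma> where "\<sigma> = 4 / 3 * (1 / 2 + \<delta>)"
  define q where "q = (2 * real n - 5) / 6"
  define \<beta> where "\<beta> = \<delta> / (21 * real n)"
  \<comment> \<open>The first bound gives 100 * n * s \<le> \<kappa>. The second gives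
    \<beta>/\<epsilon> \<ge> 1/sqrt \<epsilon>, so that the factor \<beta> costs no more than a
    factor 2 in the logarithm.\<close>
  define \<epsilon>\<^sub>0 where "\<epsilon>\<^sub>0 = min (\<kappa> / (100 * real n * real n)) (\<beta>\<^sup>2)"
  have w: "0 < \<omega>" "\<omega> \<le> 1 / 18" using n by (auto simp: \<omega>_def field_simps)
  have \<kappa>: "0 < \<kappa>" "\<kappa> \<le> 1 / 1000" using w by (auto simp: \<kappa>_def)
  have \<delta>: "0 < \<delta>" "\<delta> \<le> 1 / 16" "10 * \<delta> \<le> \<kappa>" using \<kappa> by (auto simp: \<delta>_def)
  have \<beta>: "0 < \<beta>" "\<beta> \<le> 1 / 16"
  proof -
    show "0 < \<beta>" using \<delta> n by (simp add: \<beta>_def)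
    have "\<delta> / (21 * real n) \<le> \<delta> / 1" using \<delta> n by (intro divide_left_mono) auto
    thus "\<beta> \<le> 1 / 16" using \<delta> by (simp add: \<beta>_def)
  qed
  have qp: "0 < q" using n by (simp add: q_def)
  obtain f3 F3 where f3: "has_cdf f3 F3"
    and D: "\<And>x. 0 \<le> x \<and> x \<le> 3 / 4 \<Longrightarrow> (\<sigma> + q) * F3 x = 4 / 3 * min x (1 / 2 + \<delta>)"
      "\<And>x. 3 / 4 \<le> x \<and> x \<le> 1 \<Longrightarrow> (\<sigma> + q) * F3 x = \<sigma> + q * (4 * x - 3)"
    using third_player[OF qp \<delta>(1,2)] unfolding \<sigma>_def by blast
  obtain g N where g: "has_cdf g N"
    and N: "\<And>x. x \<le> 3 / 4 \<Longrightarrow> N x = 0" "\<And>x. 3 / 4 \<le> x \<and> x \<le> 1 \<Longrightarrow> N x = 4 * x - 3"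
    using last_players by blast
  have main: "\<exists>v. cake_instance n v \<and> 1 / (2 * ln 8) * ln (1 / \<epsilon>) \<le> real (num_queries C P v)"
    if \<epsilon>: "0 < \<epsilon>" "\<epsilon> < \<epsilon>\<^sub>0" and C: "cut_rule C" and P: "rw_protocol n C P"
      and comp: "computes_connected_envy_free n \<epsilon> C P" for \<epsilon> C P
  proof -
    define s where "s = real n * \<epsilon>"
    have e1: "\<epsilon> \<le> \<kappa> / (100 * real n * real n)" and e2: "\<epsilon> \<le> \<beta>\<^sup>2"
      using \<epsilon> by (auto simp: \<epsilon>\<^sub>0_def)
    have ns: "100 * (real n * s) \<le> \<kappa>" using e1 n by (simp add: s_def field_simps)
    have sn: "1 * s \<le> real n * s" using n \<epsilon> by (intro mult_right_mono) (auto simp: s_def)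
    have en: "1 * \<epsilon> \<le> real n * \<epsilon>" using n \<epsilon> by (intro mult_right_mono) auto
    have s: "real n * s < \<omega>" "100 * s \<le> \<kappa>" "200 * \<kappa> \<le> \<omega>" "\<epsilon> \<le> \<kappa>"
      using ns sn en \<kappa> w unfolding \<kappa>_def s_def by auto
    \<comment> \<open>The mass \<eta> that players 1 and 2 have beyond 3/4 is taken to be \<epsilon>
      itself.\<close>
    interpret adversary n C P \<kappa> \<delta> \<epsilon> f3 F3 g N
      by unfold_locales (use assms C P \<kappa> \<delta> \<epsilon> s f3 g in auto)
    define X where "X = \<beta> / \<epsilon>"
    have "1 / \<epsilon> = \<epsilon> / \<epsilon>\<^sup>2" using \<epsilon> by (simp add: power2_eq_square)
    also have "\<dots> \<le> X\<^sup>2" using e2 \<epsilon> by (simp add: X_def power_divide divide_right_mono)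
    finally have X2: "1 / \<epsilon> \<le> X\<^sup>2" .
    have "\<beta>\<^sup>2 \<le> 1" using \<beta> by (simp add: power_le_one)
    hence "1 \<le> 1 / \<epsilon>" using e2 \<epsilon> by (simp add: field_simps)
    have X: "0 < X" using \<beta> \<epsilon> by (simp add: X_def)
    have X1: "1 \<le> X" using X X2 \<open>1 \<le> 1 / \<epsilon>\<close> by (smt (verit) power_le_one_iff power2_eq_square mult_less_cancel_left2)
    \<comment> \<open>The largest K with 8^K \<le> \<beta>/\<epsilon>. As \<beta> = \<delta>/(21n),
      it satisfies 21s \<le> \<delta> / 8^K; the 21 in place of 20 makes the required inequality
      strict.\<close>
    define K where "K = nat \<lfloor>log 8 X\<rfloor>"
    have l: "0 \<le> log 8 X" using X1 by simp
    have "real K \<le> log 8 X" using l by (simp add: K_def)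
    hence "8 powr real K \<le> X" using X by (simp add: le_log_iff)
    hence "8 ^ K \<le> X" by (simp add: powr_realpow)
    hence "8 ^ K * \<epsilon> \<le> \<beta>" using \<epsilon> by (simp add: X_def field_simps)
    hence "21 * s * 8 ^ K \<le> \<delta>" using n by (simp add: \<beta>_def s_def field_simps)
    hence "21 * s \<le> \<delta> / 8 ^ K" by (simp add: field_simps)
    moreover have "0 < s" using \<epsilon> n by (simp add: s_def)
    ultimately have K: "20 * s < \<delta> / 8 ^ K" by linarith
    obtain v where v: "cake_instance n v" "K < num_queries C P v"
      using many_queries[OF comp \<epsilon>(1) refl \<sigma>_def q_def \<omega>_def s_def s(1,2) \<delta>(3) s(3) D N K] by blast
    have "ln (1 / \<epsilon>) \<le> ln (X\<^sup>2)" using X2 \<epsilon> by (intro ln_mono) auto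
    also have "\<dots> = 2 * ln X" using X by (simp add: ln_realpow)
    finally have "1 / (2 * ln 8) * ln (1 / \<epsilon>) \<le> 1 / (2 * ln 8) * (2 * ln X)"
      by (intro mult_left_mono) auto
    also have "\<dots> = log 8 X" by (simp add: log_def)
    \<comment> \<open>The strict inequality K < \<open>num_queries C P v\<close> makes up for
      rounding down.\<close>
    also have "\<dots> \<le> real K + 1" using l unfolding K_def by linarith
    also have "\<dots> \<le> real (num_queries C P v)" using v(2) by linarith
    finally show ?thesis using v(1) by blast
  qed
  have "0 < \<epsilon>\<^sub>0" using \<kappa> \<beta> n by (simp add: \<epsilon>\<^sub>0_def)
  moreover have "\<epsilon>\<^sub>0 < 1"
  proof -
    have "\<beta>\<^sup>2 < 1" using \<beta> by (intro power_less_one_iff[THEN iffD2]) auto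
    thus ?thesis by (simp add: \<epsilon>\<^sub>0_def)
  qed
  moreover have "0 < 1 / (2 * ln 8 :: real)" by simp
  ultimately show ?thesis using main by blast
qed

end
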